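(* Let $0\to K\xrightarrow{\iota}B\xrightarrow{\pi}Q\to 0$ be an annihilator extension of skew braces and let $A$ be an abelian group. Then the sequence $$0\to\mathrm{Hom}(Q,A)\xrightarrow{\mathrm{Inf}}\mathrm{Hom}(B,A)\xrightarrow{\mathrm{Res}}\mathrm{Hom}(K,A)\xrightarrow{\mathrm{Tra}}H^2_b(Q,A)\xrightarrow{\mathrm{Inf}}H^2_b(B,A)$$ is exact (that is, exact at $\mathrm{Hom}(Q,A)$, $\mathrm{Hom}(B,A)$, $\mathrm{Hom}(K,A)$ and $H^2_b(Q,A)$).
   Context: A skew brace is a triple $(A,+,\circ)$ where $(A,+)$ and $(A,\circ)$ are (not necessarily abelian) groups with $a\circ(b+c)=a\circ b-a+a\circ c$ for all $a,b,c\in A$. Both groups have the same neutral element $0$; $a'$ denotes the inverse of $a$ in $(A,\circ)$. Homomorphisms of skew braces preserve both operations. An abelian group is regarded as a (trivial) skew brace with both operations equal to the group operation; $\mathrm{Hom}$ means skew brace homomorphisms. The annihilator of a skew brace $A$ is $\mathrm{Ann}(A)=\{a\in A: -a+a\circ b=b\ \forall b\in A\}\cap Z(A,+)\cap Z(A,\circ)$. An annihilator extension of $Q$ by an abelian group $K$ is a short exact sequence of skew braces $0\to K\xrightarrow{\iota}B\xrightarrow{\pi}Q\to0$ with $\iota(K)\subseteq\mathrm{Ann}(B)$. For a skew brace $Q$ and a (multiplicative) abelian group $K$, a factor set is a pair $(\alpha,\mu)$ of maps $Q\times Q\to K$ such that for all $x,y,z\in Q$: $\alpha(0,y)=\alpha(x,0)=1$,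 $\mu(0,y)=\mu(x,0)=1$, $\alpha(y,z)\alpha(x+y,z)^{-1}\alpha(x,y+z)\alpha(x,y)^{-1}=1$, $\mu(y,z)\mu(x\circ y,z)^{-1}\mu(x,y\circ z)\mu(x,y)^{-1}=1$, and $\alpha(y,z)\mu(x,y+z)\alpha(-x,x)=\mu(x,z)\alpha(x\circ y,-x)\alpha(x\circ y-x,x\circ z)\mu(x,y)$. Factor sets form a group $Z^2_b(Q,K)$ under pointwise multiplication. For $h:Q\to K$ put $\partial_+h(x,y)=h(y)h(x+y)^{-1}h(x)$ and $\partial_\circ h(x,y)=h(y)h(x\circ y)^{-1}h(x)$. Let $B^2_b(Q,K)=\{(\partial_+h,\partial_\circ h): h:Q\to K,\ h(0)=1\}$ and $H^2_b(Q,K)=Z^2_b(Q,K)/B^2_b(Q,K)$; classes are written $\overline{(\alpha,\mu)}$. A transversal of $\pi$ is a map $t:Q\to B$ with $\pi t=\mathrm{id}_Q$ and $t(0)=0$; the associated factor set of the extension is $\alpha(x,y)=\iota^{-1}(t(x)+t(y)-t(x+y))$, $\mu(x,y)=\iota^{-1}(t(x)\circ t(y)\circ t(x\circ y)')$. The maps are: $\mathrm{Inf}:\mathrm{Hom}(Q,A)\to\mathrm{Hom}(B,A)$, $\psi\mapsto\psi\pi$; $\mathrm{Res}$ is restriction to $K$ (via $\iota$); $\mathrm{Tra}(\phi)=\overline{(\phi\alpha,\phi\mu)}$ for a factor set $(\alpha,\mu)$ of the extension (independent of the choice); $\mathrm{Inf}:H^2_b(Q,A)\to H^2_b(B,A)$,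 $\overline{(\alpha_1,\mu_1)}\mapsto\overline{(\alpha_1(\pi\times\pi),\mu_1(\pi\times\pi))}$. *)

theory Defs
  imports "HOL-Algebra.AbelCoset" "HOL-Algebra.Elementary_Groups"
begin

section \<open>Skew braces\<close>

text \<open>
  The record type of rings serves as the signature of a skew brace: \<open>\<oplus>\<close>, \<open>\<ominus>\<close>, \<open>\<zero>\<close> belong to the
  (not necessarily abelian) group \<open>(A,+)\<close>, and \<open>\<otimes>\<close>, \<open>inv\<close>, \<open>\<one>\<close> to the circle group \<open>(A,\<circ>)\<close>.
  None of the ring axioms is assumed.
\<close>

locale skew_brace =
  fixes A (structure)
  assumes add_group: "group (add_monoid A)"
    and circ_group: "group A"
    and brace_law: "\<lbrakk>a \<in> carrier A; b \<in> carrier A; c \<in> carrier A\<rbrakk>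
      \<Longrightarrow> a \<otimes> (b \<oplus> c) = (a \<otimes> b \<ominus> a) \<oplus> a \<otimes> c"

lemma (in skew_brace) one_eq_zero: "\<one> = \<zero>"
proof -
  interpret add: group "add_monoid A" by (rule add_group)
  interpret circ: group A by (rule circ_group)
  have z: "\<zero> \<in> carrier A" using add.one_closed by simp
  have zz: "\<zero> \<oplus> \<zero> = \<zero>" using add.l_one[of \<zero>] z by simp
  have "\<one> = \<one> \<otimes> (\<zero> \<oplus> \<one>)" using add.l_one[of \<one>] by simp
  also have "\<dots> = \<zero> \<ominus> \<one> \<oplus> \<one>" using brace_law[of \<one> \<zero> \<one>] z by simp
  finally have "\<one> = \<zero> \<ominus> \<one> \<oplus> \<one>" .
  have "\<one> \<otimes> (\<zero> \<oplus> \<zero>) = (\<one> \<otimes> \<zero> \<ominus> \<one>) \<oplus> \<one> \<otimes> \<zero>"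
    using brace_law[of \<one> \<zero> \<zero>] z by simp
  then have "\<zero> = (\<zero> \<ominus> \<one>) \<oplus> \<zero>" using z zz by simp
  moreover have "\<ominus> \<one> \<in> carrier A" using add.inv_closed[of \<one>] by (simp add: a_inv_def)
  ultimately have "\<zero> = \<ominus> \<one>"
    using add.l_one[of "\<ominus> \<one>"] add.r_one[of "\<ominus> \<one>"] by (simp add: a_minus_def)
  then show ?thesis
    using add.r_inv[of \<one>] add.r_one[of \<one>] by (simp add: a_inv_def)
qed

definition trivial_brace :: "('a, 'm) monoid_scheme \<Rightarrow> 'a ring" where
  "trivial_brace G =
    \<lparr>carrier = carrier G, monoid.mult = monoid.mult G, one = one G, zero = one G, add = monoid.mult G\<rparr>"

lemma skew_brace_trivial_brace:
  assumes "comm_group G"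
  shows "skew_brace (trivial_brace G)"
proof -
  interpret comm_group G by (rule assms)
  have grp: "group (add_monoid (trivial_brace G))" "group (trivial_brace G)"
    by (rule groupI; auto simp: trivial_brace_def m_assoc intro: l_inv_ex)+
  interpret T: group "add_monoid (trivial_brace G)" by (rule grp)
  show ?thesis
  proof (rule skew_brace.intro[OF grp])
    fix a b c
    assume abc: "a \<in> carrier (trivial_brace G)" "b \<in> carrier (trivial_brace G)"
      "c \<in> carrier (trivial_brace G)"
    have "a_inv (trivial_brace G) a = inv\<^bsub>G\<^esub> a"
      unfolding a_inv_def
      by (rule T.inv_equality) (use abc in \<open>auto simp: trivial_brace_def\<close>)
    then show "a \<otimes>\<^bsub>trivial_brace G\<^esub> (b \<oplus>\<^bsub>trivial_brace G\<^esub> c) =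
        (a \<otimes>\<^bsub>trivial_brace G\<^esub> b \<ominus>\<^bsub>trivial_brace G\<^esub> a)
          \<oplus>\<^bsub>trivial_brace G\<^esub> a \<otimes>\<^bsub>trivial_brace G\<^esub> c"
      using abc
      by (simp add: a_minus_def)
        (simp add: trivial_brace_def m_assoc m_comm[of a] inv_solve_left)
  qed
qed

definition brace_hom :: "('a, 'm) ring_scheme \<Rightarrow> ('b, 'n) ring_scheme \<Rightarrow> ('a \<Rightarrow> 'b) set" where
  "brace_hom A B = hom (add_monoid A) (add_monoid B) \<inter> hom A B"

definition Ann :: "('a, 'm) ring_scheme \<Rightarrow> 'a set" where
  "Ann A =
    {a \<in> carrier A. \<forall>b \<in> carrier A. \<ominus>\<^bsub>A\<^esub> a \<oplus>\<^bsub>A\<^esub> a \<otimes>\<^bsub>A\<^esub> b = b}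
    \<inter> {a \<in> carrier A. \<forall>b \<in> carrier A. a \<oplus>\<^bsub>A\<^esub> b = b \<oplus>\<^bsub>A\<^esub> a}
    \<inter> {a \<in> carrier A. \<forall>b \<in> carrier A. a \<otimes>\<^bsub>A\<^esub> b = b \<otimes>\<^bsub>A\<^esub> a}"

locale annihilator_extension =
  fixes K :: "('k, 'kx) monoid_scheme"
    and \<iota> :: "'k \<Rightarrow> 'b"
    and B :: "('b, 'bx) ring_scheme"
    and \<pi> :: "'b \<Rightarrow> 'q"
    and Q :: "('q, 'qx) ring_scheme"
  assumes kernel_abelian: "comm_group K"
    and brace_B: "skew_brace B"
    and brace_Q: "skew_brace Q"
    and \<iota>_hom: "\<iota> \<in> brace_hom (trivial_brace K) B"
    and \<pi>_hom: "\<pi> \<in> brace_hom B Q"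
    and \<iota>_inj: "inj_on \<iota> (carrier K)"
    and \<iota>_\<pi>_exact: "\<iota> ` carrier K = a_kernel B Q \<pi>"
    and \<pi>_surj: "\<pi> ` carrier B = carrier Q"
    and annihilated: "\<iota> ` carrier K \<subseteq> Ann B"


section \<open>The groups\<close>

text \<open>
  Maps out of a carrier are represented by extensional functions (equal to \<open>undefined\<close> off the
  carrier), so that equality of maps is equality on the carrier.
\<close>

definition Hom :: "('q, 'qx) ring_scheme \<Rightarrow> ('a, 'ax) monoid_scheme \<Rightarrow> ('q \<Rightarrow> 'a) monoid" where
  "Hom Q A =
    \<lparr>carrier = brace_hom Q (trivial_brace A) \<inter> extensional (carrier Q),
     monoid.mult = (\<lambda>f g. \<lambda>x \<in> carrier Q. f x \<otimes>\<^bsub>A\<^esub> g x),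
     one = (\<lambda>x \<in> carrier Q. \<one>\<^bsub>A\<^esub>)\<rparr>"

type_synonym ('q, 'a) cochain_pair = "('q \<times> 'q \<Rightarrow> 'a) \<times> ('q \<times> 'q \<Rightarrow> 'a)"

definition factor_sets ::
  "('q, 'qx) ring_scheme \<Rightarrow> ('a, 'ax) monoid_scheme \<Rightarrow> ('q, 'a) cochain_pair set" where
  "factor_sets Q A =
    {(\<alpha>, \<mu>).
      \<alpha> \<in> carrier Q \<times> carrier Q \<rightarrow>\<^sub>E carrier A \<and>
      \<mu> \<in> carrier Q \<times> carrier Q \<rightarrow>\<^sub>E carrier A \<and>
      (\<forall>x \<in> carrier Q. \<forall>y \<in> carrier Q. \<forall>z \<in> carrier Q.
        \<alpha> (\<zero>\<^bsub>Q\<^esub>, y) = \<one>\<^bsub>A\<^esub> \<and> \<alpha> (x, \<zero>\<^bsub>Q\<^esub>) = \<one>\<^bsub>A\<^esub> \<and>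
        \<mu> (\<zero>\<^bsub>Q\<^esub>, y) = \<one>\<^bsub>A\<^esub> \<and> \<mu> (x, \<zero>\<^bsub>Q\<^esub>) = \<one>\<^bsub>A\<^esub> \<and>
        \<alpha> (y, z) \<otimes>\<^bsub>A\<^esub> inv\<^bsub>A\<^esub> \<alpha> (x \<oplus>\<^bsub>Q\<^esub> y, z) \<otimes>\<^bsub>A\<^esub> \<alpha> (x, y \<oplus>\<^bsub>Q\<^esub> z) \<otimes>\<^bsub>A\<^esub> inv\<^bsub>A\<^esub> \<alpha> (x, y) = \<one>\<^bsub>A\<^esub> \<and>
        \<mu> (y, z) \<otimes>\<^bsub>A\<^esub> inv\<^bsub>A\<^esub> \<mu> (x \<otimes>\<^bsub>Q\<^esub> y, z) \<otimes>\<^bsub>A\<^esub> \<mu> (x, y \<otimes>\<^bsub>Q\<^esub> z) \<otimes>\<^bsub>A\<^esub> inv\<^bsub>A\<^esub> \<mu> (x, y) = \<one>\<^bsub>A\<^esub> \<and>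
        \<alpha> (y, z) \<otimes>\<^bsub>A\<^esub> \<mu> (x, y \<oplus>\<^bsub>Q\<^esub> z) \<otimes>\<^bsub>A\<^esub> \<alpha> (\<ominus>\<^bsub>Q\<^esub> x, x) =
        \<mu> (x, z) \<otimes>\<^bsub>A\<^esub> \<alpha> (x \<otimes>\<^bsub>Q\<^esub> y, \<ominus>\<^bsub>Q\<^esub> x)
          \<otimes>\<^bsub>A\<^esub> \<alpha> (x \<otimes>\<^bsub>Q\<^esub> y \<ominus>\<^bsub>Q\<^esub> x, x \<otimes>\<^bsub>Q\<^esub> z) \<otimes>\<^bsub>A\<^esub> \<mu> (x, y))}"

definition Z2b ::
  "('q, 'qx) ring_scheme \<Rightarrow> ('a, 'ax) monoid_scheme \<Rightarrow> ('q, 'a) cochain_pair monoid" where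
  "Z2b Q A =
    \<lparr>carrier = factor_sets Q A,
     monoid.mult = (\<lambda>(\<alpha>, \<mu>) (\<alpha>', \<mu>').
       (\<lambda>p \<in> carrier Q \<times> carrier Q. \<alpha> p \<otimes>\<^bsub>A\<^esub> \<alpha>' p,
        \<lambda>p \<in> carrier Q \<times> carrier Q. \<mu> p \<otimes>\<^bsub>A\<^esub> \<mu>' p)),
     one = (\<lambda>p \<in> carrier Q \<times> carrier Q. \<one>\<^bsub>A\<^esub>, \<lambda>p \<in> carrier Q \<times> carrier Q. \<one>\<^bsub>A\<^esub>)\<rparr>"

definition coboundary_add ::
  "('q, 'qx) ring_scheme \<Rightarrow> ('a, 'ax) monoid_scheme \<Rightarrow> ('q \<Rightarrow> 'a) \<Rightarrow> 'q \<times> 'q \<Rightarrow> 'a" where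
  "coboundary_add Q A h =
    (\<lambda>(x, y) \<in> carrier Q \<times> carrier Q. h y \<otimes>\<^bsub>A\<^esub> inv\<^bsub>A\<^esub> h (x \<oplus>\<^bsub>Q\<^esub> y) \<otimes>\<^bsub>A\<^esub> h x)"

definition coboundary_circ ::
  "('q, 'qx) ring_scheme \<Rightarrow> ('a, 'ax) monoid_scheme \<Rightarrow> ('q \<Rightarrow> 'a) \<Rightarrow> 'q \<times> 'q \<Rightarrow> 'a" where
  "coboundary_circ Q A h =
    (\<lambda>(x, y) \<in> carrier Q \<times> carrier Q. h y \<otimes>\<^bsub>A\<^esub> inv\<^bsub>A\<^esub> h (x \<otimes>\<^bsub>Q\<^esub> y) \<otimes>\<^bsub>A\<^esub> h x)"

definition B2b ::
  "('q, 'qx) ring_scheme \<Rightarrow> ('a, 'ax) monoid_scheme \<Rightarrow> ('q, 'a) cochain_pair set" where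
  "B2b Q A = {(coboundary_add Q A h, coboundary_circ Q A h) | h.
     h \<in> carrier Q \<rightarrow> carrier A \<and> h \<zero>\<^bsub>Q\<^esub> = \<one>\<^bsub>A\<^esub>}"

definition H2b ::
  "('q, 'qx) ring_scheme \<Rightarrow> ('a, 'ax) monoid_scheme \<Rightarrow> ('q, 'a) cochain_pair set monoid" where
  "H2b Q A = Z2b Q A Mod B2b Q A"

definition H2b_class ::
  "('q, 'qx) ring_scheme \<Rightarrow> ('a, 'ax) monoid_scheme \<Rightarrow> ('q, 'a) cochain_pair
    \<Rightarrow> ('q, 'a) cochain_pair set" where
  "H2b_class Q A c = B2b Q A #>\<^bsub>Z2b Q A\<^esub> c"


section \<open>The maps\<close>

definition transversals ::
  "('b, 'bx) ring_scheme \<Rightarrow> ('b \<Rightarrow> 'q) \<Rightarrow> ('q, 'qx) ring_scheme \<Rightarrow> ('q \<Rightarrow> 'b) set" where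
  "transversals B \<pi> Q =
    {t \<in> carrier Q \<rightarrow> carrier B. (\<forall>x \<in> carrier Q. \<pi> (t x) = x) \<and> t \<zero>\<^bsub>Q\<^esub> = \<zero>\<^bsub>B\<^esub>}"

definition extension_factor_set ::
  "('k, 'kx) monoid_scheme \<Rightarrow> ('k \<Rightarrow> 'b) \<Rightarrow> ('b, 'bx) ring_scheme \<Rightarrow> ('q, 'qx) ring_scheme
    \<Rightarrow> ('q \<Rightarrow> 'b) \<Rightarrow> ('q, 'k) cochain_pair" where
  "extension_factor_set K \<iota> B Q t =
    (\<lambda>(x, y) \<in> carrier Q \<times> carrier Q.
        inv_into (carrier K) \<iota> (t x \<oplus>\<^bsub>B\<^esub> t y \<ominus>\<^bsub>B\<^esub> t (x \<oplus>\<^bsub>Q\<^esub> y)),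
     \<lambda>(x, y) \<in> carrier Q \<times> carrier Q.
        inv_into (carrier K) \<iota> (t x \<otimes>\<^bsub>B\<^esub> t y \<otimes>\<^bsub>B\<^esub> inv\<^bsub>B\<^esub> t (x \<otimes>\<^bsub>Q\<^esub> y)))"

definition Inf_Hom :: "('b, 'bx) ring_scheme \<Rightarrow> ('b \<Rightarrow> 'q) \<Rightarrow> ('q \<Rightarrow> 'a) \<Rightarrow> 'b \<Rightarrow> 'a" where
  "Inf_Hom B \<pi> \<psi> = compose (carrier B) \<psi> \<pi>"

definition Res_Hom :: "('k, 'kx) monoid_scheme \<Rightarrow> ('k \<Rightarrow> 'b) \<Rightarrow> ('b \<Rightarrow> 'a) \<Rightarrow> 'k \<Rightarrow> 'a" where
  "Res_Hom K \<iota> \<psi> = compose (carrier K) \<psi> \<iota>"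

text \<open>
  In the next two definitions \<open>the_elem\<close> extracts the unique element of the set of all classes
  obtained from the possible choices: of a transversal for \<open>Tra\<close>, and of a representative of the
  class \<open>c\<close> for \<open>Inf_H2b\<close>.
\<close>

definition Tra ::
  "('k, 'kx) monoid_scheme \<Rightarrow> ('k \<Rightarrow> 'b) \<Rightarrow> ('b, 'bx) ring_scheme \<Rightarrow> ('b \<Rightarrow> 'q)
    \<Rightarrow> ('q, 'qx) ring_scheme \<Rightarrow> ('a, 'ax) monoid_scheme \<Rightarrow> ('k \<Rightarrow> 'a)
    \<Rightarrow> ('q, 'a) cochain_pair set" where
  "Tra K \<iota> B \<pi> Q A \<phi> = the_elem
    ((\<lambda>t. let (\<alpha>, \<mu>) = extension_factor_set K \<iota> B Q t in
        H2b_class Q A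
          (compose (carrier Q \<times> carrier Q) \<phi> \<alpha>, compose (carrier Q \<times> carrier Q) \<phi> \<mu>))
     ` transversals B \<pi> Q)"

definition Inf_H2b ::
  "('b, 'bx) ring_scheme \<Rightarrow> ('b \<Rightarrow> 'q) \<Rightarrow> ('a, 'ax) monoid_scheme
    \<Rightarrow> ('q, 'a) cochain_pair set \<Rightarrow> ('b, 'a) cochain_pair set" where
  "Inf_H2b B \<pi> A c = the_elem
    ((\<lambda>(\<alpha>, \<mu>). H2b_class B A
        (compose (carrier B \<times> carrier B) \<alpha> (map_prod \<pi> \<pi>),
         compose (carrier B \<times> carrier B) \<mu> (map_prod \<pi> \<pi>)))
     ` c)"


section \<open>Exactness\<close>

definition exact_at ::
  "('x, 'xx) monoid_scheme \<Rightarrow> ('x \<Rightarrow> 'y) \<Rightarrow> ('y, 'yx) monoid_scheme \<Rightarrow> ('y \<Rightarrow> 'z)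
    \<Rightarrow> ('z, 'zx) monoid_scheme \<Rightarrow> bool" where
  "exact_at F f G g H \<longleftrightarrow> group_hom F G f \<and> group_hom G H g \<and> f ` carrier F = kernel G H g"

end

theory Submission
  imports Defs
begin

text \<open>
  Fix a transversal \<open>t\<close> with factor set \<open>(\<alpha>, \<mu>)\<close> and write every \<open>b\<close> in \<open>B\<close> uniquely as
  \<open>b = \<iota> (k b) + t (\<pi> b)\<close>. As \<open>\<iota> K\<close> lies in the annihilator,
  \<open>k (a + b) = k a \<cdot> k b \<cdot> \<alpha> (\<pi> a, \<pi> b)\<close> and \<open>k (a \<circ> b) = k a \<cdot> k b \<cdot> \<mu> (\<pi> a, \<pi> b)\<close>. Hence for
  \<open>\<phi>\<close> in \<open>Hom(K, A)\<close> the inflation of \<open>(\<phi>\<alpha>, \<phi>\<mu>)\<close> to \<open>B\<close> is the coboundary of \<open>1 / (\<phi> \<circ> k)\<close>.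
  If \<open>(\<phi>\<alpha>, \<phi>\<mu>)\<close> is already the coboundary of \<open>h\<close> on \<open>Q\<close>, then \<open>b \<mapsto> \<phi> (k b) \<cdot> h (\<pi> b)\<close> is a
  homomorphism extending \<open>\<phi>\<close>. Conversely, if a factor set on \<open>Q\<close> inflates to the coboundary of \<open>h\<close> on
  \<open>B\<close>, normalisation makes \<open>h (\<iota> k + b) = h (\<iota> k) \<cdot> h b\<close>, so \<open>\<phi> = 1 / (h \<circ> \<iota>)\<close> is a homomorphism on
  \<open>K\<close>, and the factor set differs from \<open>(\<phi>\<alpha>, \<phi>\<mu>)\<close> by the coboundary of \<open>h \<circ> t\<close>.
\<close>

section \<open>Cohomology of skew braces\<close>

context comm_group
begin

text \<open>Moving \<open>inv b\<close> to the other side leaves an identity between products, which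
  the rules \<open>m_ac\<close> can settle; several later cancellation steps come down to
  this.\<close>

lemma quotient_eq_iff:
  assumes "a \<in> carrier G" "b \<in> carrier G" "c \<in> carrier G" "d \<in> carrier G"
  shows "a \<otimes> inv b \<otimes> c = d \<longleftrightarrow> a \<otimes> c = b \<otimes> d"
proof -
  have "a \<otimes> inv b \<otimes> c = inv b \<otimes> (a \<otimes> c)"
    using assms by (simp add: m_ac)
  then show ?thesis
    using assms inv_solve_left'[of d b "a \<otimes> c"] by auto
qed

text \<open>This is the shape of the two cocycle conditions in \<open>factor_sets\<close>, which can
  thus be replaced by inverse-free forms.\<close>

lemma quotient_eq_one_iff:
  assumes "a \<in> carrier G" "b \<in> carrier G" "c \<in> carrier G" "d \<in> carrier G"
  shows "a \<otimes> inv b \<otimes> c \<otimes> inv d = \<one> \<longleftrightarrow> a \<otimes> c = b \<otimes> d"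
proof -
  have "a \<otimes> inv b \<otimes> c \<otimes> inv d = \<one> \<longleftrightarrow> a \<otimes> inv b \<otimes> c = d"
    using assms by (simp add: inv_solve_right')
  then show ?thesis using assms by (simp add: quotient_eq_iff)
qed

text \<open>Shaped after the condition that links the two cochains, with three factors on one side
  and four on the other: the product of two solutions is a solution.\<close>

lemma mult_eq_mult_4:
  assumes "a \<in> carrier G" "b \<in> carrier G" "c \<in> carrier G"
    and "a' \<in> carrier G" "b' \<in> carrier G" "c' \<in> carrier G"
    and "d \<in> carrier G" "e \<in> carrier G" "f \<in> carrier G" "g \<in> carrier G"
    and "d' \<in> carrier G" "e' \<in> carrier G" "f' \<in> carrier G" "g' \<in> carrier G"
    and "a \<otimes> b \<otimes> c = d \<otimes> e \<otimes> f \<otimes> g" "a' \<otimes> b' \<otimes> c' = d' \<otimes> e' \<otimes> f' \<otimes> g'"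
  shows "(a \<otimes> a') \<otimes> (b \<otimes> b') \<otimes> (c \<otimes> c') = (d \<otimes> d') \<otimes> (e \<otimes> e') \<otimes> (f \<otimes> f') \<otimes> (g \<otimes> g')"
proof -
  have "(a \<otimes> a') \<otimes> (b \<otimes> b') \<otimes> (c \<otimes> c') = (a \<otimes> b \<otimes> c) \<otimes> (a' \<otimes> b' \<otimes> c')"
    using assms(1-6) by (simp add: m_ac)
  also have "\<dots> = (d \<otimes> e \<otimes> f \<otimes> g) \<otimes> (d' \<otimes> e' \<otimes> f' \<otimes> g')"
    by (simp only: assms(15,16))
  also have "\<dots> = (d \<otimes> d') \<otimes> (e \<otimes> e') \<otimes> (f \<otimes> f') \<otimes> (g \<otimes> g')"
    using assms(7-14) by (simp add: m_ac)
  finally show ?thesis .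
qed

lemma mult_eq_mult_2:
  assumes "a \<in> carrier G" "b \<in> carrier G" "a' \<in> carrier G" "b' \<in> carrier G"
    and "d \<in> carrier G" "e \<in> carrier G" "d' \<in> carrier G" "e' \<in> carrier G"
    and "a \<otimes> b = d \<otimes> e" "a' \<otimes> b' = d' \<otimes> e'"
  shows "(a \<otimes> a') \<otimes> (b \<otimes> b') = (d \<otimes> d') \<otimes> (e \<otimes> e')"
  using mult_eq_mult_4[of a b \<one> a' b' \<one> d e \<one> \<one> d' e' \<one> \<one>] assms by simp

end

context skew_brace
begin

sublocale circ: group A
  by (rule circ_group)

text \<open>The rewrites replace the selectors of \<open>add_monoid A\<close> by the brace notation,
  so that group facts apply directly to sums, negatives and zero of the brace.\<close>

sublocale add: group "add_monoid A"
  rewrites "carrier (add_monoid A) = carrier A"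
    and "monoid.mult (add_monoid A) = add A"
    and "one (add_monoid A) = zero A"
    and "m_inv (add_monoid A) = a_inv A"
  by (rule add_group) (auto simp: a_inv_def[abs_def])

end

text \<open>Both cochains come from the same \<open>h\<close>; pairing them presents
  \<open>B2b\<close> as the image of a single map.\<close>

definition coboundary ::
  "('q, 'qx) ring_scheme \<Rightarrow> ('a, 'ax) monoid_scheme \<Rightarrow> ('q \<Rightarrow> 'a) \<Rightarrow> ('q, 'a) cochain_pair" where
  "coboundary Q A h = (coboundary_add Q A h, coboundary_circ Q A h)"

locale brace_cohomology = brace: skew_brace Q + coeff: comm_group A
  for Q :: "('q, 'qx) ring_scheme" and A :: "('a, 'ax) monoid_scheme"
begin

section \<open>The group of homomorphisms\<close>

lemma Hom_carrier_iff:
  "f \<in> carrier (Hom Q A) \<longleftrightarrow> f \<in> carrier Q \<rightarrow>\<^sub>E carrier A \<and>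
    (\<forall>x \<in> carrier Q. \<forall>y \<in> carrier Q. f (x \<oplus>\<^bsub>Q\<^esub> y) = f x \<otimes>\<^bsub>A\<^esub> f y \<and>
      f (x \<otimes>\<^bsub>Q\<^esub> y) = f x \<otimes>\<^bsub>A\<^esub> f y)"
  by (auto simp: Hom_def brace_hom_def hom_def trivial_brace_def PiE_def)

lemma Hom_apply:
  assumes "f \<in> carrier (Hom Q A)"
  shows Hom_closed: "x \<in> carrier Q \<Longrightarrow> f x \<in> carrier A"
    and Hom_add: "\<lbrakk>x \<in> carrier Q; y \<in> carrier Q\<rbrakk> \<Longrightarrow> f (x \<oplus>\<^bsub>Q\<^esub> y) = f x \<otimes>\<^bsub>A\<^esub> f y"
    and Hom_circ: "\<lbrakk>x \<in> carrier Q; y \<in> carrier Q\<rbrakk> \<Longrightarrow> f (x \<otimes>\<^bsub>Q\<^esub> y) = f x \<otimes>\<^bsub>A\<^esub> f y"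
    and Hom_zero: "f \<zero>\<^bsub>Q\<^esub> = \<one>\<^bsub>A\<^esub>"
proof -
  show "x \<in> carrier Q \<Longrightarrow> f x \<in> carrier A"
    and add: "\<lbrakk>x \<in> carrier Q; y \<in> carrier Q\<rbrakk> \<Longrightarrow> f (x \<oplus>\<^bsub>Q\<^esub> y) = f x \<otimes>\<^bsub>A\<^esub> f y"
    and "\<lbrakk>x \<in> carrier Q; y \<in> carrier Q\<rbrakk> \<Longrightarrow> f (x \<otimes>\<^bsub>Q\<^esub> y) = f x \<otimes>\<^bsub>A\<^esub> f y" for x y
    using assms by (auto simp: Hom_carrier_iff)
  have "f \<zero>\<^bsub>Q\<^esub> \<in> carrier A"
    using assms by (auto simp: Hom_carrier_iff)
  \<comment> \<open>The image of zero is idempotent, and a group has only one idempotent.\<close>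
  then show "f \<zero>\<^bsub>Q\<^esub> = \<one>\<^bsub>A\<^esub>"
    using add[of "\<zero>\<^bsub>Q\<^esub>" "\<zero>\<^bsub>Q\<^esub>"] by simp
qed

text \<open>Commutativity of \<open>A\<close> makes pointwise products and inverses of homomorphisms
  homomorphisms again.\<close>

lemma comm_group_Hom: "comm_group (Hom Q A)"
proof (rule comm_groupI)
  fix f assume f: "f \<in> carrier (Hom Q A)"
  define g where "g = (\<lambda>x \<in> carrier Q. inv\<^bsub>A\<^esub> f x)"
  have "g \<in> carrier (Hom Q A)"
    using f by (auto simp: Hom_carrier_iff g_def coeff.inv_mult PiE_iff)
  moreover have "g \<otimes>\<^bsub>Hom Q A\<^esub> f = \<one>\<^bsub>Hom Q A\<^esub>"
    using f by (auto simp: Hom_carrier_iff g_def PiE_iff) (auto simp: Hom_def fun_eq_iff)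
  ultimately show "\<exists>g \<in> carrier (Hom Q A). g \<otimes>\<^bsub>Hom Q A\<^esub> f = \<one>\<^bsub>Hom Q A\<^esub>"
    by blast
next
  fix f g assume "f \<in> carrier (Hom Q A)" "g \<in> carrier (Hom Q A)"
  then have "(\<lambda>x \<in> carrier Q. f x \<otimes>\<^bsub>A\<^esub> g x) \<in> carrier (Hom Q A)"
    by (auto simp: Hom_carrier_iff coeff.m_ac Pi_iff PiE_iff)
  then show "f \<otimes>\<^bsub>Hom Q A\<^esub> g \<in> carrier (Hom Q A)"
    by (simp add: Hom_def)
next
  have "(\<lambda>x \<in> carrier Q. \<one>\<^bsub>A\<^esub>) \<in> carrier (Hom Q A)"
    by (auto simp: Hom_carrier_iff)
  then show "\<one>\<^bsub>Hom Q A\<^esub> \<in> carrier (Hom Q A)"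
    by (simp add: Hom_def)
next
  fix f g h assume "f \<in> carrier (Hom Q A)" "g \<in> carrier (Hom Q A)" "h \<in> carrier (Hom Q A)"
  then show "f \<otimes>\<^bsub>Hom Q A\<^esub> g \<otimes>\<^bsub>Hom Q A\<^esub> h = f \<otimes>\<^bsub>Hom Q A\<^esub> (g \<otimes>\<^bsub>Hom Q A\<^esub> h)"
    by (auto simp: Hom_carrier_iff PiE_iff) (auto simp: Hom_def fun_eq_iff coeff.m_assoc)
next
  fix f g assume "f \<in> carrier (Hom Q A)" "g \<in> carrier (Hom Q A)"
  then show "f \<otimes>\<^bsub>Hom Q A\<^esub> g = g \<otimes>\<^bsub>Hom Q A\<^esub> f"
    by (auto simp: Hom_carrier_iff PiE_iff) (auto simp: Hom_def fun_eq_iff coeff.m_comm)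
next
  fix f assume "f \<in> carrier (Hom Q A)"
  then show "\<one>\<^bsub>Hom Q A\<^esub> \<otimes>\<^bsub>Hom Q A\<^esub> f = f"
    by (auto simp: Hom_carrier_iff PiE_iff) (auto simp: Hom_def fun_eq_iff extensional_def)
qed

section \<open>The group of factor sets, with inverse-free conditions\<close>

lemma factor_sets_iff:
  "c \<in> factor_sets Q A \<longleftrightarrow>
    fst c \<in> carrier Q \<times> carrier Q \<rightarrow>\<^sub>E carrier A \<and>
    snd c \<in> carrier Q \<times> carrier Q \<rightarrow>\<^sub>E carrier A \<and>
    (\<forall>x \<in> carrier Q. \<forall>y \<in> carrier Q. \<forall>z \<in> carrier Q.
      fst c (\<zero>\<^bsub>Q\<^esub>, y) = \<one>\<^bsub>A\<^esub> \<and> fst c (x, \<zero>\<^bsub>Q\<^esub>) = \<one>\<^bsub>A\<^esub> \<and>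
      snd c (\<zero>\<^bsub>Q\<^esub>, y) = \<one>\<^bsub>A\<^esub> \<and> snd c (x, \<zero>\<^bsub>Q\<^esub>) = \<one>\<^bsub>A\<^esub> \<and>
      fst c (y, z) \<otimes>\<^bsub>A\<^esub> fst c (x, y \<oplus>\<^bsub>Q\<^esub> z) = fst c (x \<oplus>\<^bsub>Q\<^esub> y, z) \<otimes>\<^bsub>A\<^esub> fst c (x, y) \<and>
      snd c (y, z) \<otimes>\<^bsub>A\<^esub> snd c (x, y \<otimes>\<^bsub>Q\<^esub> z) = snd c (x \<otimes>\<^bsub>Q\<^esub> y, z) \<otimes>\<^bsub>A\<^esub> snd c (x, y) \<and>
      fst c (y, z) \<otimes>\<^bsub>A\<^esub> snd c (x, y \<oplus>\<^bsub>Q\<^esub> z) \<otimes>\<^bsub>A\<^esub> fst c (\<ominus>\<^bsub>Q\<^esub> x, x) =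
        snd c (x, z) \<otimes>\<^bsub>A\<^esub> fst c (x \<otimes>\<^bsub>Q\<^esub> y, \<ominus>\<^bsub>Q\<^esub> x)
          \<otimes>\<^bsub>A\<^esub> fst c (x \<otimes>\<^bsub>Q\<^esub> y \<oplus>\<^bsub>Q\<^esub> \<ominus>\<^bsub>Q\<^esub> x, x \<otimes>\<^bsub>Q\<^esub> z) \<otimes>\<^bsub>A\<^esub> snd c (x, y))"
proof (cases c)
  case (Pair \<alpha> \<mu>)
  show ?thesis
  \<comment> \<open>Inverses can be cleared only once all values are known to lie in
    \<open>carrier A\<close>; otherwise both sides are false.\<close>
  proof (cases "\<alpha> \<in> carrier Q \<times> carrier Q \<rightarrow>\<^sub>E carrier A \<and> \<mu> \<in> carrier Q \<times> carrier Q \<rightarrow>\<^sub>E carrier A")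
    case True
    then have "\<And>x y. \<lbrakk>x \<in> carrier Q; y \<in> carrier Q\<rbrakk> \<Longrightarrow> \<alpha> (x, y) \<in> carrier A"
      "\<And>x y. \<lbrakk>x \<in> carrier Q; y \<in> carrier Q\<rbrakk> \<Longrightarrow> \<mu> (x, y) \<in> carrier A"
      by (auto simp: PiE_iff)
    then show ?thesis
      unfolding factor_sets_def Pair using True
      by (simp add: coeff.quotient_eq_one_iff a_minus_def cong: conj_cong)
  next
    case False
    then show ?thesis unfolding factor_sets_def Pair by auto
  qed
qed

lemma factor_set_closed:
  assumes "c \<in> factor_sets Q A" "x \<in> carrier Q" "y \<in> carrier Q"
  shows "fst c (x, y) \<in> carrier A" "snd c (x, y) \<in> carrier A"
  using assms by (auto simp: factor_sets_iff PiE_iff)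

lemma factor_set_zero_left:
  "\<lbrakk>c \<in> factor_sets Q A; x \<in> carrier Q\<rbrakk> \<Longrightarrow> fst c (\<zero>\<^bsub>Q\<^esub>, x) = \<one>\<^bsub>A\<^esub>"
  unfolding factor_sets_iff by blast

lemma factor_set_ext:
  assumes "c \<in> extensional (carrier Q \<times> carrier Q) \<times> extensional (carrier Q \<times> carrier Q)"
    and "d \<in> extensional (carrier Q \<times> carrier Q) \<times> extensional (carrier Q \<times> carrier Q)"
    and "\<And>x y. \<lbrakk>x \<in> carrier Q; y \<in> carrier Q\<rbrakk> \<Longrightarrow> fst c (x, y) = fst d (x, y)"
    and "\<And>x y. \<lbrakk>x \<in> carrier Q; y \<in> carrier Q\<rbrakk> \<Longrightarrow> snd c (x, y) = snd d (x, y)"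
  shows "c = d"
  using assms by (intro prod_eqI extensionalityI[of _ "carrier Q \<times> carrier Q"]) auto

lemma Z2b_mult:
  "c \<otimes>\<^bsub>Z2b Q A\<^esub> d =
    (\<lambda>p \<in> carrier Q \<times> carrier Q. fst c p \<otimes>\<^bsub>A\<^esub> fst d p,
     \<lambda>p \<in> carrier Q \<times> carrier Q. snd c p \<otimes>\<^bsub>A\<^esub> snd d p)"
  by (simp add: Z2b_def case_prod_unfold)

lemma Z2b_simps:
  "carrier (Z2b Q A) = factor_sets Q A"
  "\<one>\<^bsub>Z2b Q A\<^esub> = (\<lambda>p \<in> carrier Q \<times> carrier Q. \<one>\<^bsub>A\<^esub>, \<lambda>p \<in> carrier Q \<times> carrier Q. \<one>\<^bsub>A\<^esub>)"
  by (simp_all add: Z2b_def)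

lemma factor_set_extensional:
  "c \<in> factor_sets Q A \<Longrightarrow>
    c \<in> extensional (carrier Q \<times> carrier Q) \<times> extensional (carrier Q \<times> carrier Q)"
  by (cases c) (auto simp: factor_sets_iff PiE_iff)

text \<open>Every identity compares products of values, so multiplying those for \<open>c\<close>
  and \<open>d\<close> termwise gives the one for their product.\<close>

lemma factor_sets_mult_closed:
  assumes "c \<in> factor_sets Q A" "d \<in> factor_sets Q A"
  shows "c \<otimes>\<^bsub>Z2b Q A\<^esub> d \<in> factor_sets Q A"
proof -
  note cl = factor_set_closed[OF assms(1)] factor_set_closed[OF assms(2)]
  show ?thesis
    unfolding factor_sets_iff
  proof (intro conjI ballI)
    show "fst (c \<otimes>\<^bsub>Z2b Q A\<^esub> d) \<in> carrier Q \<times> carrier Q \<rightarrow>\<^sub>E carrier A"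
      "snd (c \<otimes>\<^bsub>Z2b Q A\<^esub> d) \<in> carrier Q \<times> carrier Q \<rightarrow>\<^sub>E carrier A"
      by (auto simp: Z2b_mult cl)
  next
    fix x y z assume "x \<in> carrier Q" "y \<in> carrier Q" "z \<in> carrier Q"
    then show "fst (c \<otimes>\<^bsub>Z2b Q A\<^esub> d) (y, z) \<otimes>\<^bsub>A\<^esub> snd (c \<otimes>\<^bsub>Z2b Q A\<^esub> d) (x, y \<oplus>\<^bsub>Q\<^esub> z)
        \<otimes>\<^bsub>A\<^esub> fst (c \<otimes>\<^bsub>Z2b Q A\<^esub> d) (\<ominus>\<^bsub>Q\<^esub> x, x) =
      snd (c \<otimes>\<^bsub>Z2b Q A\<^esub> d) (x, z) \<otimes>\<^bsub>A\<^esub> fst (c \<otimes>\<^bsub>Z2b Q A\<^esub> d) (x \<otimes>\<^bsub>Q\<^esub> y, \<ominus>\<^bsub>Q\<^esub> x)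
        \<otimes>\<^bsub>A\<^esub> fst (c \<otimes>\<^bsub>Z2b Q A\<^esub> d) (x \<otimes>\<^bsub>Q\<^esub> y \<oplus>\<^bsub>Q\<^esub> \<ominus>\<^bsub>Q\<^esub> x, x \<otimes>\<^bsub>Q\<^esub> z)
        \<otimes>\<^bsub>A\<^esub> snd (c \<otimes>\<^bsub>Z2b Q A\<^esub> d) (x, y)"
      using assms by (simp add: Z2b_mult cl, intro coeff.mult_eq_mult_4)
        (simp_all add: cl factor_sets_iff)
  qed (use assms in \<open>auto simp: factor_sets_iff Z2b_mult cl intro!: coeff.mult_eq_mult_2\<close>)
qed

lemma comm_group_Z2b: "comm_group (Z2b Q A)"
proof (rule comm_groupI)
  fix c d assume "c \<in> carrier (Z2b Q A)" "d \<in> carrier (Z2b Q A)"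
  then show "c \<otimes>\<^bsub>Z2b Q A\<^esub> d \<in> carrier (Z2b Q A)"
    by (simp add: Z2b_simps factor_sets_mult_closed)
next
  show "\<one>\<^bsub>Z2b Q A\<^esub> \<in> carrier (Z2b Q A)"
    by (simp add: Z2b_simps factor_sets_iff)
next
  fix c d e assume "c \<in> carrier (Z2b Q A)" "d \<in> carrier (Z2b Q A)" "e \<in> carrier (Z2b Q A)"
  then show "c \<otimes>\<^bsub>Z2b Q A\<^esub> d \<otimes>\<^bsub>Z2b Q A\<^esub> e = c \<otimes>\<^bsub>Z2b Q A\<^esub> (d \<otimes>\<^bsub>Z2b Q A\<^esub> e)"
    by (auto simp: Z2b_mult Z2b_simps fun_eq_iff factor_set_closed coeff.m_assoc)
next
  fix c d assume "c \<in> carrier (Z2b Q A)" "d \<in> carrier (Z2b Q A)"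
  then show "c \<otimes>\<^bsub>Z2b Q A\<^esub> d = d \<otimes>\<^bsub>Z2b Q A\<^esub> c"
    by (auto simp: Z2b_mult Z2b_simps fun_eq_iff factor_set_closed coeff.m_comm)
next
  fix c assume c: "c \<in> carrier (Z2b Q A)"
  then show "\<one>\<^bsub>Z2b Q A\<^esub> \<otimes>\<^bsub>Z2b Q A\<^esub> c = c"
    using factor_set_closed[of c] factor_set_extensional[of c]
    by (intro factor_set_ext) (auto simp: Z2b_mult Z2b_simps)
  note cl = factor_set_closed[OF c[unfolded Z2b_simps]]
  define d where "d = (\<lambda>p \<in> carrier Q \<times> carrier Q. inv\<^bsub>A\<^esub> fst c p,
     \<lambda>p \<in> carrier Q \<times> carrier Q. inv\<^bsub>A\<^esub> snd c p)"
  \<comment> \<open>Inversion distributes over products in an abelian group, so inverting the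
    identities for \<open>c\<close> gives those for \<open>d\<close>.\<close>
  have "d \<in> carrier (Z2b Q A)"
    using c by (simp add: d_def factor_sets_iff Z2b_simps cl PiE_iff flip: coeff.inv_mult)
  moreover have "d \<otimes>\<^bsub>Z2b Q A\<^esub> c = \<one>\<^bsub>Z2b Q A\<^esub>"
    using cl by (auto simp: d_def Z2b_mult Z2b_simps fun_eq_iff)
  ultimately show "\<exists>d \<in> carrier (Z2b Q A). d \<otimes>\<^bsub>Z2b Q A\<^esub> c = \<one>\<^bsub>Z2b Q A\<^esub>" ..
qed

section \<open>Coboundaries\<close>

lemma coboundary_apply:
  assumes "x \<in> carrier Q" "y \<in> carrier Q"
  shows "fst (coboundary Q A h) (x, y) = h y \<otimes>\<^bsub>A\<^esub> inv\<^bsub>A\<^esub> h (x \<oplus>\<^bsub>Q\<^esub> y) \<otimes>\<^bsub>A\<^esub> h x"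
    "snd (coboundary Q A h) (x, y) = h y \<otimes>\<^bsub>A\<^esub> inv\<^bsub>A\<^esub> h (x \<otimes>\<^bsub>Q\<^esub> y) \<otimes>\<^bsub>A\<^esub> h x"
  using assms by (simp_all add: coboundary_def coboundary_add_def coboundary_circ_def)

lemma coboundary_extensional:
  "coboundary Q A h \<in> extensional (carrier Q \<times> carrier Q) \<times> extensional (carrier Q \<times> carrier Q)"
  by (simp add: coboundary_def coboundary_add_def coboundary_circ_def)

lemma coboundary_closed:
  assumes "h \<in> carrier Q \<rightarrow> carrier A" "x \<in> carrier Q" "y \<in> carrier Q"
  shows "fst (coboundary Q A h) (x, y) \<in> carrier A" "snd (coboundary Q A h) (x, y) \<in> carrier A"
  using assms by (auto simp: coboundary_apply Pi_iff)

text \<open>The inverse-free form shows a coboundary as the defect of \<open>h\<close> from being a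
  homomorphism.\<close>

lemma coboundary_mult_apply:
  assumes "h \<in> carrier Q \<rightarrow> carrier A" "x \<in> carrier Q" "y \<in> carrier Q"
  shows "fst (coboundary Q A h) (x, y) \<otimes>\<^bsub>A\<^esub> h (x \<oplus>\<^bsub>Q\<^esub> y) = h x \<otimes>\<^bsub>A\<^esub> h y"
    "snd (coboundary Q A h) (x, y) \<otimes>\<^bsub>A\<^esub> h (x \<otimes>\<^bsub>Q\<^esub> y) = h x \<otimes>\<^bsub>A\<^esub> h y"
proof -
  have [simp]: "h z \<in> carrier A" if "z \<in> carrier Q" for z
    using assms(1) that by auto
  have cancel: "b \<otimes>\<^bsub>A\<^esub> inv\<^bsub>A\<^esub> c \<otimes>\<^bsub>A\<^esub> a \<otimes>\<^bsub>A\<^esub> c = a \<otimes>\<^bsub>A\<^esub> b"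
    if "a \<in> carrier A" "b \<in> carrier A" "c \<in> carrier A" for a b c
    using that coeff.quotient_eq_iff[of b c a "b \<otimes>\<^bsub>A\<^esub> inv\<^bsub>A\<^esub> c \<otimes>\<^bsub>A\<^esub> a"]
    by (simp add: coeff.m_comm)
  show "fst (coboundary Q A h) (x, y) \<otimes>\<^bsub>A\<^esub> h (x \<oplus>\<^bsub>Q\<^esub> y) = h x \<otimes>\<^bsub>A\<^esub> h y"
    "snd (coboundary Q A h) (x, y) \<otimes>\<^bsub>A\<^esub> h (x \<otimes>\<^bsub>Q\<^esub> y) = h x \<otimes>\<^bsub>A\<^esub> h y"
    using assms by (simp_all add: coboundary_apply cancel)
qed

text \<open>For the three main identities, both sides are multiplied by a product \<open>?k\<close>
  of values of \<open>h\<close>, chosen so that \<open>coboundary_mult_apply\<close> removes every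
  cochain value; what is left agrees up to order, and \<open>?k\<close> is cancelled.\<close>

lemma coboundary_factor_set:
  assumes "h \<in> carrier Q \<rightarrow> carrier A" "h \<zero>\<^bsub>Q\<^esub> = \<one>\<^bsub>A\<^esub>"
  shows "coboundary Q A h \<in> factor_sets Q A"
proof -
  have h[simp]: "h x \<in> carrier A" if "x \<in> carrier Q" for x
    using assms(1) that by auto
  let ?\<alpha> = "fst (coboundary Q A h)" and ?\<mu> = "snd (coboundary Q A h)"
  note [simp] = coboundary_closed[OF assms(1)]
  note \<alpha> = coboundary_mult_apply(1)[OF assms(1)] and \<mu> = coboundary_mult_apply(2)[OF assms(1)]
  show ?thesis
    unfolding factor_sets_iff
  proof (intro conjI ballI)
    show "?\<alpha> \<in> carrier Q \<times> carrier Q \<rightarrow>\<^sub>E carrier A" "?\<mu> \<in> carrier Q \<times> carrier Q \<rightarrow>\<^sub>E carrier A"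
      by (auto simp: coboundary_def coboundary_add_def coboundary_circ_def)
  next
    fix x y z assume xyz[simp]: "x \<in> carrier Q" "y \<in> carrier Q" "z \<in> carrier Q"
    \<comment> \<open>By \<open>one_eq_zero\<close>, zero is neutral for the circle operation as
      well.\<close>
    have [simp]: "\<zero>\<^bsub>Q\<^esub> \<otimes>\<^bsub>Q\<^esub> y = y" "x \<otimes>\<^bsub>Q\<^esub> \<zero>\<^bsub>Q\<^esub> = x"
      using brace.circ.l_one[OF xyz(2)] brace.circ.r_one[OF xyz(1)] by (simp_all only: brace.one_eq_zero)
    show "?\<alpha> (\<zero>\<^bsub>Q\<^esub>, y) = \<one>\<^bsub>A\<^esub>" "?\<alpha> (x, \<zero>\<^bsub>Q\<^esub>) = \<one>\<^bsub>A\<^esub>"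
      "?\<mu> (\<zero>\<^bsub>Q\<^esub>, y) = \<one>\<^bsub>A\<^esub>" "?\<mu> (x, \<zero>\<^bsub>Q\<^esub>) = \<one>\<^bsub>A\<^esub>"
      by (simp_all add: coboundary_apply assms(2))
    let ?s = "h (x \<oplus>\<^bsub>Q\<^esub> y \<oplus>\<^bsub>Q\<^esub> z)"
    let ?k = "h (y \<oplus>\<^bsub>Q\<^esub> z) \<otimes>\<^bsub>A\<^esub> h (x \<oplus>\<^bsub>Q\<^esub> y) \<otimes>\<^bsub>A\<^esub> ?s"
    have "?\<alpha> (y, z) \<otimes>\<^bsub>A\<^esub> ?\<alpha> (x, y \<oplus>\<^bsub>Q\<^esub> z) \<otimes>\<^bsub>A\<^esub> ?k =
      (?\<alpha> (y, z) \<otimes>\<^bsub>A\<^esub> h (y \<oplus>\<^bsub>Q\<^esub> z)) \<otimes>\<^bsub>A\<^esub> (?\<alpha> (x, y \<oplus>\<^bsub>Q\<^esub> z) \<otimes>\<^bsub>A\<^esub> h (x \<oplus>\<^bsub>Q\<^esub> (y \<oplus>\<^bsub>Q\<^esub> z)))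
        \<otimes>\<^bsub>A\<^esub> h (x \<oplus>\<^bsub>Q\<^esub> y)"
      by (simp add: coeff.m_ac brace.add.m_assoc)
    also have "\<dots> = (h y \<otimes>\<^bsub>A\<^esub> h z) \<otimes>\<^bsub>A\<^esub> (h x \<otimes>\<^bsub>A\<^esub> h (y \<oplus>\<^bsub>Q\<^esub> z)) \<otimes>\<^bsub>A\<^esub> h (x \<oplus>\<^bsub>Q\<^esub> y)"
      by (simp add: \<alpha>)
    also have "\<dots> = (h (x \<oplus>\<^bsub>Q\<^esub> y) \<otimes>\<^bsub>A\<^esub> h z) \<otimes>\<^bsub>A\<^esub> (h x \<otimes>\<^bsub>A\<^esub> h y) \<otimes>\<^bsub>A\<^esub> h (y \<oplus>\<^bsub>Q\<^esub> z)"
      by (simp add: coeff.m_ac)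
    also have "\<dots> = (?\<alpha> (x \<oplus>\<^bsub>Q\<^esub> y, z) \<otimes>\<^bsub>A\<^esub> ?s) \<otimes>\<^bsub>A\<^esub> (?\<alpha> (x, y) \<otimes>\<^bsub>A\<^esub> h (x \<oplus>\<^bsub>Q\<^esub> y)) \<otimes>\<^bsub>A\<^esub> h (y \<oplus>\<^bsub>Q\<^esub> z)"
      by (simp add: \<alpha>)
    also have "\<dots> = ?\<alpha> (x \<oplus>\<^bsub>Q\<^esub> y, z) \<otimes>\<^bsub>A\<^esub> ?\<alpha> (x, y) \<otimes>\<^bsub>A\<^esub> ?k"
      by (simp add: coeff.m_ac)
    finally show "?\<alpha> (y, z) \<otimes>\<^bsub>A\<^esub> ?\<alpha> (x, y \<oplus>\<^bsub>Q\<^esub> z) = ?\<alpha> (x \<oplus>\<^bsub>Q\<^esub> y, z) \<otimes>\<^bsub>A\<^esub> ?\<alpha> (x, y)"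
      by (subst (asm) coeff.right_cancel) auto
    let ?s = "h (x \<otimes>\<^bsub>Q\<^esub> y \<otimes>\<^bsub>Q\<^esub> z)"
    let ?k = "h (y \<otimes>\<^bsub>Q\<^esub> z) \<otimes>\<^bsub>A\<^esub> h (x \<otimes>\<^bsub>Q\<^esub> y) \<otimes>\<^bsub>A\<^esub> ?s"
    have "?\<mu> (y, z) \<otimes>\<^bsub>A\<^esub> ?\<mu> (x, y \<otimes>\<^bsub>Q\<^esub> z) \<otimes>\<^bsub>A\<^esub> ?k =
      (?\<mu> (y, z) \<otimes>\<^bsub>A\<^esub> h (y \<otimes>\<^bsub>Q\<^esub> z)) \<otimes>\<^bsub>A\<^esub> (?\<mu> (x, y \<otimes>\<^bsub>Q\<^esub> z) \<otimes>\<^bsub>A\<^esub> h (x \<otimes>\<^bsub>Q\<^esub> (y \<otimes>\<^bsub>Q\<^esub> z)))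
        \<otimes>\<^bsub>A\<^esub> h (x \<otimes>\<^bsub>Q\<^esub> y)"
      by (simp add: coeff.m_ac brace.circ.m_assoc)
    also have "\<dots> = (h y \<otimes>\<^bsub>A\<^esub> h z) \<otimes>\<^bsub>A\<^esub> (h x \<otimes>\<^bsub>A\<^esub> h (y \<otimes>\<^bsub>Q\<^esub> z)) \<otimes>\<^bsub>A\<^esub> h (x \<otimes>\<^bsub>Q\<^esub> y)"
      by (simp add: \<mu>)
    also have "\<dots> = (h (x \<otimes>\<^bsub>Q\<^esub> y) \<otimes>\<^bsub>A\<^esub> h z) \<otimes>\<^bsub>A\<^esub> (h x \<otimes>\<^bsub>A\<^esub> h y) \<otimes>\<^bsub>A\<^esub> h (y \<otimes>\<^bsub>Q\<^esub> z)"
      by (simp add: coeff.m_ac)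
    also have "\<dots> = (?\<mu> (x \<otimes>\<^bsub>Q\<^esub> y, z) \<otimes>\<^bsub>A\<^esub> ?s) \<otimes>\<^bsub>A\<^esub> (?\<mu> (x, y) \<otimes>\<^bsub>A\<^esub> h (x \<otimes>\<^bsub>Q\<^esub> y)) \<otimes>\<^bsub>A\<^esub> h (y \<otimes>\<^bsub>Q\<^esub> z)"
      by (simp add: \<mu>)
    also have "\<dots> = ?\<mu> (x \<otimes>\<^bsub>Q\<^esub> y, z) \<otimes>\<^bsub>A\<^esub> ?\<mu> (x, y) \<otimes>\<^bsub>A\<^esub> ?k"
      by (simp add: coeff.m_ac)
    finally show "?\<mu> (y, z) \<otimes>\<^bsub>A\<^esub> ?\<mu> (x, y \<otimes>\<^bsub>Q\<^esub> z) = ?\<mu> (x \<otimes>\<^bsub>Q\<^esub> y, z) \<otimes>\<^bsub>A\<^esub> ?\<mu> (x, y)"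
      by (subst (asm) coeff.right_cancel) auto
    let ?m = "\<ominus>\<^bsub>Q\<^esub> x" and ?p = "x \<otimes>\<^bsub>Q\<^esub> y" and ?q = "x \<otimes>\<^bsub>Q\<^esub> z"
    let ?s = "h (x \<otimes>\<^bsub>Q\<^esub> (y \<oplus>\<^bsub>Q\<^esub> z))"
    let ?L = "?\<alpha> (y, z) \<otimes>\<^bsub>A\<^esub> ?\<mu> (x, y \<oplus>\<^bsub>Q\<^esub> z) \<otimes>\<^bsub>A\<^esub> ?\<alpha> (?m, x)"
    let ?R = "?\<mu> (x, z) \<otimes>\<^bsub>A\<^esub> ?\<alpha> (?p, ?m) \<otimes>\<^bsub>A\<^esub> ?\<alpha> (?p \<oplus>\<^bsub>Q\<^esub> ?m, ?q) \<otimes>\<^bsub>A\<^esub> ?\<mu> (x, y)"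
    let ?k = "h (y \<oplus>\<^bsub>Q\<^esub> z) \<otimes>\<^bsub>A\<^esub> ?s \<otimes>\<^bsub>A\<^esub> h ?q \<otimes>\<^bsub>A\<^esub> h (?p \<oplus>\<^bsub>Q\<^esub> ?m) \<otimes>\<^bsub>A\<^esub> h ?p"
    \<comment> \<open>The brace law lets the same value \<open>?s\<close> serve on both
      sides.\<close>
    have law: "x \<otimes>\<^bsub>Q\<^esub> (y \<oplus>\<^bsub>Q\<^esub> z) = ?p \<oplus>\<^bsub>Q\<^esub> ?m \<oplus>\<^bsub>Q\<^esub> ?q"
      using brace.brace_law[OF xyz] by (simp add: a_minus_def)
    \<comment> \<open>The arguments sum to zero, where \<open>h\<close> is normalised, so this value
      needs no factor in \<open>?k\<close>.\<close>
    have "?\<alpha> (?m, x) = h ?m \<otimes>\<^bsub>A\<^esub> h x"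
      using \<alpha>[of ?m x] by (simp add: assms(2))
    then have "?L \<otimes>\<^bsub>A\<^esub> ?k =
      (?\<alpha> (y, z) \<otimes>\<^bsub>A\<^esub> h (y \<oplus>\<^bsub>Q\<^esub> z)) \<otimes>\<^bsub>A\<^esub> (?\<mu> (x, y \<oplus>\<^bsub>Q\<^esub> z) \<otimes>\<^bsub>A\<^esub> ?s)
        \<otimes>\<^bsub>A\<^esub> (h ?m \<otimes>\<^bsub>A\<^esub> h x) \<otimes>\<^bsub>A\<^esub> (h ?q \<otimes>\<^bsub>A\<^esub> h (?p \<oplus>\<^bsub>Q\<^esub> ?m) \<otimes>\<^bsub>A\<^esub> h ?p)"
      by (simp add: coeff.m_ac)
    also have "\<dots> = (h y \<otimes>\<^bsub>A\<^esub> h z) \<otimes>\<^bsub>A\<^esub> (h x \<otimes>\<^bsub>A\<^esub> h (y \<oplus>\<^bsub>Q\<^esub> z))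
        \<otimes>\<^bsub>A\<^esub> (h ?m \<otimes>\<^bsub>A\<^esub> h x) \<otimes>\<^bsub>A\<^esub> (h ?q \<otimes>\<^bsub>A\<^esub> h (?p \<oplus>\<^bsub>Q\<^esub> ?m) \<otimes>\<^bsub>A\<^esub> h ?p)"
      by (simp add: \<alpha> \<mu>)
    also have "\<dots> = (h x \<otimes>\<^bsub>A\<^esub> h z) \<otimes>\<^bsub>A\<^esub> (h ?p \<otimes>\<^bsub>A\<^esub> h ?m) \<otimes>\<^bsub>A\<^esub> (h (?p \<oplus>\<^bsub>Q\<^esub> ?m) \<otimes>\<^bsub>A\<^esub> h ?q)
        \<otimes>\<^bsub>A\<^esub> (h x \<otimes>\<^bsub>A\<^esub> h y) \<otimes>\<^bsub>A\<^esub> h (y \<oplus>\<^bsub>Q\<^esub> z)"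
      by (simp add: coeff.m_ac)
    also have "\<dots> = (?\<mu> (x, z) \<otimes>\<^bsub>A\<^esub> h ?q) \<otimes>\<^bsub>A\<^esub> (?\<alpha> (?p, ?m) \<otimes>\<^bsub>A\<^esub> h (?p \<oplus>\<^bsub>Q\<^esub> ?m))
        \<otimes>\<^bsub>A\<^esub> (?\<alpha> (?p \<oplus>\<^bsub>Q\<^esub> ?m, ?q) \<otimes>\<^bsub>A\<^esub> ?s) \<otimes>\<^bsub>A\<^esub> (?\<mu> (x, y) \<otimes>\<^bsub>A\<^esub> h ?p) \<otimes>\<^bsub>A\<^esub> h (y \<oplus>\<^bsub>Q\<^esub> z)"
      by (simp add: \<alpha> \<mu> law)
    also have "\<dots> = ?R \<otimes>\<^bsub>A\<^esub> ?k"
      by (simp add: coeff.m_ac)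
    finally show "?L = ?R"
      by (subst (asm) coeff.right_cancel) auto
  qed
qed

text \<open>Commutativity of \<open>A\<close> makes the coboundary multiplicative in
  \<open>h\<close>, from which the subgroup property of \<open>B2b\<close> follows.\<close>

lemma coboundary_mult:
  assumes "h \<in> carrier Q \<rightarrow> carrier A" "g \<in> carrier Q \<rightarrow> carrier A"
  shows "coboundary Q A h \<otimes>\<^bsub>Z2b Q A\<^esub> coboundary Q A g = coboundary Q A (\<lambda>x. h x \<otimes>\<^bsub>A\<^esub> g x)"
proof -
  have [simp]: "h x \<in> carrier A" "g x \<in> carrier A" if "x \<in> carrier Q" for x
    using assms that by auto
  show ?thesis
    by (rule factor_set_ext)
      (use coboundary_extensional in \<open>auto simp: Z2b_mult coboundary_apply coeff.inv_mult coeff.m_ac\<close>)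
qed

lemma B2b_eq: "B2b Q A = coboundary Q A ` {h \<in> carrier Q \<rightarrow> carrier A. h \<zero>\<^bsub>Q\<^esub> = \<one>\<^bsub>A\<^esub>}"
  by (auto simp: B2b_def coboundary_def)

lemma subgroup_B2b: "subgroup (B2b Q A) (Z2b Q A)"
proof -
  interpret Z: comm_group "Z2b Q A" by (rule comm_group_Z2b)
  have one: "coboundary Q A (\<lambda>x. \<one>\<^bsub>A\<^esub>) = \<one>\<^bsub>Z2b Q A\<^esub>"
    by (rule factor_set_ext)
      (use coboundary_extensional in \<open>auto simp: Z2b_simps coboundary_apply\<close>)
  show ?thesis
  proof (rule Z.subgroupI)
    show sub: "B2b Q A \<subseteq> carrier (Z2b Q A)"
      by (auto simp: B2b_eq Z2b_simps coboundary_factor_set)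
    show "B2b Q A \<noteq> {}"
      by (auto simp: B2b_eq)
    show "c \<otimes>\<^bsub>Z2b Q A\<^esub> d \<in> B2b Q A" if "c \<in> B2b Q A" "d \<in> B2b Q A" for c d
    proof -
      from that obtain h g where hg: "c = coboundary Q A h" "d = coboundary Q A g"
        "h \<in> carrier Q \<rightarrow> carrier A" "g \<in> carrier Q \<rightarrow> carrier A" "h \<zero>\<^bsub>Q\<^esub> = \<one>\<^bsub>A\<^esub>" "g \<zero>\<^bsub>Q\<^esub> = \<one>\<^bsub>A\<^esub>"
        by (auto simp: B2b_eq)
      then show ?thesis
        unfolding B2b_eq by (intro image_eqI[of _ _ "\<lambda>x. h x \<otimes>\<^bsub>A\<^esub> g x"]) (auto simp: coboundary_mult)
    qed
    show "inv\<^bsub>Z2b Q A\<^esub> c \<in> B2b Q A" if "c \<in> B2b Q A" for c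
    proof -
      from that obtain h where h: "c = coboundary Q A h"
        "h \<in> carrier Q \<rightarrow> carrier A" "h \<zero>\<^bsub>Q\<^esub> = \<one>\<^bsub>A\<^esub>"
        by (auto simp: B2b_eq)
      let ?g = "\<lambda>x. inv\<^bsub>A\<^esub> h x"
      have g: "?g \<in> carrier Q \<rightarrow> carrier A" "?g \<zero>\<^bsub>Q\<^esub> = \<one>\<^bsub>A\<^esub>"
        using h by auto
      have "coboundary Q A ?g \<otimes>\<^bsub>Z2b Q A\<^esub> c = coboundary Q A (\<lambda>x. ?g x \<otimes>\<^bsub>A\<^esub> h x)"
        using g h by (simp add: coboundary_mult)
      also have "\<dots> = coboundary Q A (\<lambda>x. \<one>\<^bsub>A\<^esub>)"
        using h by (intro factor_set_ext)
          (use coboundary_extensional in \<open>auto simp: coboundary_apply Pi_iff\<close>)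
      finally have "coboundary Q A ?g \<otimes>\<^bsub>Z2b Q A\<^esub> c = \<one>\<^bsub>Z2b Q A\<^esub>"
        by (simp add: one)
      then have "inv\<^bsub>Z2b Q A\<^esub> c = coboundary Q A ?g"
        using g that sub by (intro Z.inv_equality) (auto simp: Z2b_simps coboundary_factor_set)
      then show ?thesis using g by (auto simp: B2b_eq)
    qed
  qed
qed

lemma normal_B2b: "B2b Q A \<lhd> Z2b Q A"
proof -
  interpret Z: comm_group "Z2b Q A" by (rule comm_group_Z2b)
  show ?thesis by (rule Z.subgroup_imp_normal[OF subgroup_B2b])
qed

section \<open>The quotient group of classes\<close>

lemma group_H2b: "group (H2b Q A)"
  unfolding H2b_def by (rule normal.factorgroup_is_group[OF normal_B2b])

lemma one_H2b: "\<one>\<^bsub>H2b Q A\<^esub> = B2b Q A"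
  by (simp add: H2b_def FactGroup_def)

lemma carrier_H2b: "carrier (H2b Q A) = H2b_class Q A ` factor_sets Q A"
  by (auto simp: H2b_def FactGroup_def RCOSETS_def H2b_class_def Z2b_simps)

lemma mult_H2b:
  assumes "c \<in> factor_sets Q A" "d \<in> factor_sets Q A"
  shows "H2b_class Q A c \<otimes>\<^bsub>H2b Q A\<^esub> H2b_class Q A d = H2b_class Q A (c \<otimes>\<^bsub>Z2b Q A\<^esub> d)"
  using normal.rcos_sum[OF normal_B2b] assms
  by (simp add: H2b_def H2b_class_def FactGroup_def Z2b_simps)

lemma H2b_class_coboundary_mult:
  assumes "c \<in> factor_sets Q A" "b \<in> B2b Q A"
  shows "H2b_class Q A (b \<otimes>\<^bsub>Z2b Q A\<^esub> c) = H2b_class Q A c"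
proof -
  interpret Z: comm_group "Z2b Q A" by (rule comm_group_Z2b)
  have "b \<otimes>\<^bsub>Z2b Q A\<^esub> c \<in> B2b Q A #>\<^bsub>Z2b Q A\<^esub> c"
    using assms by (auto simp: r_coset_def)
  then show ?thesis
    unfolding H2b_class_def
    using Z.repr_independence[OF _ _ subgroup_B2b] assms by (simp add: Z2b_simps)
qed

text \<open>A coset of a subgroup is the subgroup itself exactly when its representative lies there;
  this turns the kernels of \<open>Tra\<close> and \<open>Inf_H2b\<close> into conditions on
  membership in \<open>B2b\<close>.\<close>

lemma H2b_class_eq_one_iff:
  assumes "c \<in> factor_sets Q A"
  shows "H2b_class Q A c = B2b Q A \<longleftrightarrow> c \<in> B2b Q A"
proof -
  interpret Z: comm_group "Z2b Q A" by (rule comm_group_Z2b)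
  show ?thesis
    unfolding H2b_class_def
    using Z.coset_join1[OF _ _ subgroup_B2b, of c] Z.coset_join2[OF _ subgroup_B2b, of c] assms
      subgroup.subset[OF subgroup_B2b] by (metis Z2b_simps(1))
qed

end

section \<open>Annihilator extensions\<close>

context annihilator_extension
begin

sublocale B: skew_brace B
  by (rule brace_B)

sublocale Q: skew_brace Q
  by (rule brace_Q)

sublocale K: comm_group K
  by (rule kernel_abelian)

section \<open>Consequences of exactness and of the annihilator condition\<close>

lemma \<pi>_closed[simp]: "b \<in> carrier B \<Longrightarrow> \<pi> b \<in> carrier Q"
  using \<pi>_surj by auto

lemma \<pi>_add[simp]: "\<lbrakk>a \<in> carrier B; b \<in> carrier B\<rbrakk> \<Longrightarrow> \<pi> (a \<oplus>\<^bsub>B\<^esub> b) = \<pi> a \<oplus>\<^bsub>Q\<^esub> \<pi> b"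
  and \<pi>_circ[simp]: "\<lbrakk>a \<in> carrier B; b \<in> carrier B\<rbrakk> \<Longrightarrow> \<pi> (a \<otimes>\<^bsub>B\<^esub> b) = \<pi> a \<otimes>\<^bsub>Q\<^esub> \<pi> b"
  using \<pi>_hom by (auto simp: brace_hom_def hom_def)

lemma \<pi>_zero[simp]: "\<pi> \<zero>\<^bsub>B\<^esub> = \<zero>\<^bsub>Q\<^esub>"
  and \<pi>_minus[simp]: "b \<in> carrier B \<Longrightarrow> \<pi> (\<ominus>\<^bsub>B\<^esub> b) = \<ominus>\<^bsub>Q\<^esub> \<pi> b"
proof -
  interpret group_hom "add_monoid B" "add_monoid Q" \<pi>
    using \<pi>_hom B.add_group Q.add_group
    by (auto simp: group_hom_def group_hom_axioms_def brace_hom_def)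
  show "\<pi> \<zero>\<^bsub>B\<^esub> = \<zero>\<^bsub>Q\<^esub>" and "b \<in> carrier B \<Longrightarrow> \<pi> (\<ominus>\<^bsub>B\<^esub> b) = \<ominus>\<^bsub>Q\<^esub> \<pi> b"
    using hom_one hom_inv[of b] by (simp_all add: a_inv_def)
qed

lemma \<iota>_closed[simp]: "k \<in> carrier K \<Longrightarrow> \<iota> k \<in> carrier B"
  and \<iota>_mult[simp]: "\<lbrakk>k \<in> carrier K; l \<in> carrier K\<rbrakk> \<Longrightarrow> \<iota> (k \<otimes>\<^bsub>K\<^esub> l) = \<iota> k \<oplus>\<^bsub>B\<^esub> \<iota> l"
  using \<iota>_hom by (auto simp: brace_hom_def hom_def trivial_brace_def)

lemma \<iota>_one[simp]: "\<iota> \<one>\<^bsub>K\<^esub> = \<zero>\<^bsub>B\<^esub>"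
  using \<iota>_mult[of "\<one>\<^bsub>K\<^esub>" "\<one>\<^bsub>K\<^esub>"] by simp

lemma
  assumes "k \<in> carrier K" "b \<in> carrier B"
  shows \<iota>_add_commute: "b \<oplus>\<^bsub>B\<^esub> \<iota> k = \<iota> k \<oplus>\<^bsub>B\<^esub> b"
    and \<iota>_circ_commute: "b \<otimes>\<^bsub>B\<^esub> \<iota> k = \<iota> k \<otimes>\<^bsub>B\<^esub> b"
    and \<iota>_minus_circ: "\<ominus>\<^bsub>B\<^esub> \<iota> k \<oplus>\<^bsub>B\<^esub> \<iota> k \<otimes>\<^bsub>B\<^esub> b = b"
proof -
  have "\<iota> k \<in> Ann B"
    using annihilated assms(1) by auto
  then have "\<iota> k \<oplus>\<^bsub>B\<^esub> b = b \<oplus>\<^bsub>B\<^esub> \<iota> k" "\<iota> k \<otimes>\<^bsub>B\<^esub> b = b \<otimes>\<^bsub>B\<^esub> \<iota> k"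
    "\<ominus>\<^bsub>B\<^esub> \<iota> k \<oplus>\<^bsub>B\<^esub> \<iota> k \<otimes>\<^bsub>B\<^esub> b = b"
    using assms(2) unfolding Ann_def by blast+
  then show "b \<oplus>\<^bsub>B\<^esub> \<iota> k = \<iota> k \<oplus>\<^bsub>B\<^esub> b" "b \<otimes>\<^bsub>B\<^esub> \<iota> k = \<iota> k \<otimes>\<^bsub>B\<^esub> b"
    "\<ominus>\<^bsub>B\<^esub> \<iota> k \<oplus>\<^bsub>B\<^esub> \<iota> k \<otimes>\<^bsub>B\<^esub> b = b"
    by (simp_all only:)
qed

text \<open>Obtained by adding \<open>\<iota> k\<close> on the left in
  \<open>\<iota>_minus_circ\<close>. Because the two operations agree here, one
  \<open>K\<close>-coordinate serves for sums and circle products alike.\<close>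

lemma \<iota>_circ:
  assumes "k \<in> carrier K" "b \<in> carrier B"
  shows "\<iota> k \<otimes>\<^bsub>B\<^esub> b = \<iota> k \<oplus>\<^bsub>B\<^esub> b"
proof -
  have "\<iota> k \<oplus>\<^bsub>B\<^esub> b = \<iota> k \<oplus>\<^bsub>B\<^esub> (\<ominus>\<^bsub>B\<^esub> \<iota> k \<oplus>\<^bsub>B\<^esub> \<iota> k \<otimes>\<^bsub>B\<^esub> b)"
    using assms by (simp only: \<iota>_minus_circ)
  also have "\<dots> = \<iota> k \<otimes>\<^bsub>B\<^esub> b"
    using assms by (simp flip: B.add.m_assoc)
  finally show ?thesis by simp
qed

lemma \<pi>_\<iota>[simp]: "k \<in> carrier K \<Longrightarrow> \<pi> (\<iota> k) = \<zero>\<^bsub>Q\<^esub>"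
  using \<iota>_\<pi>_exact by (auto simp: a_kernel_def kernel_def)

text \<open>\<open>coord t b\<close> is the \<open>K\<close>-coordinate of \<open>b\<close> in the decomposition \<open>b = \<iota> k + t x\<close>.\<close>

definition coord :: "('q \<Rightarrow> 'b) \<Rightarrow> 'b \<Rightarrow> 'k" where
  "coord t b = inv_into (carrier K) \<iota> (b \<ominus>\<^bsub>B\<^esub> t (\<pi> b))"

section \<open>Transversals and the coordinates they define\<close>

lemma transversal:
  assumes "t \<in> transversals B \<pi> Q"
  shows "x \<in> carrier Q \<Longrightarrow> t x \<in> carrier B" "x \<in> carrier Q \<Longrightarrow> \<pi> (t x) = x"
    and "t \<zero>\<^bsub>Q\<^esub> = \<zero>\<^bsub>B\<^esub>"
  using assms by (auto simp: transversals_def)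

lemma transversal_exists: "transversals B \<pi> Q \<noteq> {}"
proof -
  \<comment> \<open>Preimages exist by surjectivity; the value at zero is set by hand to achieve the
    normalisation.\<close>
  let ?t = "\<lambda>x. if x = \<zero>\<^bsub>Q\<^esub> then \<zero>\<^bsub>B\<^esub> else inv_into (carrier B) \<pi> x"
  have "inv_into (carrier B) \<pi> x \<in> carrier B \<and> \<pi> (inv_into (carrier B) \<pi> x) = x"
    if "x \<in> carrier Q" for x
    using that \<pi>_surj by (metis f_inv_into_f inv_into_into)
  then have "?t \<in> transversals B \<pi> Q"
    by (auto simp: transversals_def)
  then show ?thesis by blast
qed

context
  fixes t assumes t[simp]: "t \<in> transversals B \<pi> Q"
begin

lemma coord:
  assumes b[simp]: "b \<in> carrier B"
  shows coord_closed: "coord t b \<in> carrier K"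
    and coord_decomp: "\<iota> (coord t b) \<oplus>\<^bsub>B\<^esub> t (\<pi> b) = b"
proof -
  note [simp] = transversal[OF t]
  \<comment> \<open>The difference lies in the kernel of \<open>\<pi>\<close>, which exactness
    identifies with the image of \<open>\<iota>\<close>.\<close>
  have "\<pi> (b \<ominus>\<^bsub>B\<^esub> t (\<pi> b)) = \<zero>\<^bsub>Q\<^esub>"
    by (simp add: a_minus_def)
  then have "b \<ominus>\<^bsub>B\<^esub> t (\<pi> b) \<in> \<iota> ` carrier K"
    using \<iota>_\<pi>_exact by (simp add: a_kernel_def kernel_def a_minus_def)
  then show "coord t b \<in> carrier K" "\<iota> (coord t b) \<oplus>\<^bsub>B\<^esub> t (\<pi> b) = b"
    unfolding coord_def
    by (simp_all add: inv_into_into f_inv_into_f) (simp add: a_minus_def B.add.m_assoc)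
qed

lemma coord_unique:
  assumes [simp]: "k \<in> carrier K" "x \<in> carrier Q"
  shows "coord t (\<iota> k \<oplus>\<^bsub>B\<^esub> t x) = k"
  unfolding coord_def using \<iota>_inj by (simp add: transversal[OF t] a_minus_def B.add.m_assoc)

text \<open>Adding \<open>\<iota> k\<close> does not change the image under \<open>\<pi>\<close>, so
  only the \<open>K\<close>-part of \<open>b\<close> is affected.\<close>

lemma coord_\<iota>_add:
  assumes [simp]: "k \<in> carrier K" "b \<in> carrier B"
  shows "coord t (\<iota> k \<oplus>\<^bsub>B\<^esub> b) = k \<otimes>\<^bsub>K\<^esub> coord t b"
proof -
  note [simp] = transversal[OF t] coord_closed
  have "\<iota> k \<oplus>\<^bsub>B\<^esub> b = \<iota> (k \<otimes>\<^bsub>K\<^esub> coord t b) \<oplus>\<^bsub>B\<^esub> t (\<pi> b)"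
    by (simp add: B.add.m_assoc coord_decomp)
  then show ?thesis by (simp only:) (simp add: coord_unique del: \<iota>_mult)
qed

lemma coord_\<iota>: "k \<in> carrier K \<Longrightarrow> coord t (\<iota> k) = k"
  using coord_unique[of k "\<zero>\<^bsub>Q\<^esub>"] by (simp add: transversal[OF t])

lemma coord_transversal: "x \<in> carrier Q \<Longrightarrow> coord t (t x) = \<one>\<^bsub>K\<^esub>"
  using coord_unique[of "\<one>\<^bsub>K\<^esub>" x] by (simp add: transversal[OF t])

text \<open>The additive part is immediate from the definitions. For the other, the definition
  divides by the transversal value in the circle group, whereas \<open>coord\<close> subtracts it;
  by \<open>\<iota>_circ\<close> both give the same element of \<open>K\<close>.\<close>

lemma extension_factor_set_apply:
  assumes [simp]: "x \<in> carrier Q" "y \<in> carrier Q"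
  shows "fst (extension_factor_set K \<iota> B Q t) (x, y) = coord t (t x \<oplus>\<^bsub>B\<^esub> t y)"
    and "snd (extension_factor_set K \<iota> B Q t) (x, y) = coord t (t x \<otimes>\<^bsub>B\<^esub> t y)"
proof -
  note [simp] = transversal[OF t]
  show "fst (extension_factor_set K \<iota> B Q t) (x, y) = coord t (t x \<oplus>\<^bsub>B\<^esub> t y)"
    by (simp add: extension_factor_set_def coord_def)
  let ?k = "coord t (t x \<otimes>\<^bsub>B\<^esub> t y)" and ?s = "t (x \<otimes>\<^bsub>Q\<^esub> y)"
  have k: "?k \<in> carrier K" by (simp add: coord_closed)
  have "t x \<otimes>\<^bsub>B\<^esub> t y = \<iota> ?k \<otimes>\<^bsub>B\<^esub> ?s"
    using coord_decomp[of "t x \<otimes>\<^bsub>B\<^esub> t y"] k by (simp add: \<iota>_circ)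
  then have "t x \<otimes>\<^bsub>B\<^esub> t y \<otimes>\<^bsub>B\<^esub> inv\<^bsub>B\<^esub> ?s = \<iota> ?k"
    using k by (simp add: B.circ.inv_solve_right')
  then show "snd (extension_factor_set K \<iota> B Q t) (x, y) = ?k"
    using k \<iota>_inj by (simp add: extension_factor_set_def)
qed

lemma extension_factor_set_closed:
  assumes [simp]: "x \<in> carrier Q" "y \<in> carrier Q"
  shows "fst (extension_factor_set K \<iota> B Q t) (x, y) \<in> carrier K"
    and "snd (extension_factor_set K \<iota> B Q t) (x, y) \<in> carrier K"
  by (simp_all add: extension_factor_set_apply coord_closed transversal[OF t])

lemma coord_add:
  assumes [simp]: "a \<in> carrier B" "b \<in> carrier B"
  shows "coord t (a \<oplus>\<^bsub>B\<^esub> b) =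
    coord t a \<otimes>\<^bsub>K\<^esub> coord t b \<otimes>\<^bsub>K\<^esub> fst (extension_factor_set K \<iota> B Q t) (\<pi> a, \<pi> b)"
proof -
  note [simp] = transversal[OF t] coord_closed
  let ?k = "coord t a" and ?l = "coord t b"
  have "a \<oplus>\<^bsub>B\<^esub> b = (\<iota> ?k \<oplus>\<^bsub>B\<^esub> t (\<pi> a)) \<oplus>\<^bsub>B\<^esub> (\<iota> ?l \<oplus>\<^bsub>B\<^esub> t (\<pi> b))"
    by (simp add: coord_decomp)
  also have "\<dots> = \<iota> ?k \<oplus>\<^bsub>B\<^esub> (t (\<pi> a) \<oplus>\<^bsub>B\<^esub> \<iota> ?l) \<oplus>\<^bsub>B\<^esub> t (\<pi> b)"
    by (simp add: B.add.m_assoc)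
  \<comment> \<open>Additive centrality moves \<open>\<iota> ?l\<close> past
    \<open>t (\<pi> a)\<close>.\<close>
  also have "\<dots> = \<iota> (?k \<otimes>\<^bsub>K\<^esub> ?l) \<oplus>\<^bsub>B\<^esub> (t (\<pi> a) \<oplus>\<^bsub>B\<^esub> t (\<pi> b))"
    by (simp add: \<iota>_add_commute[of ?l "t (\<pi> a)"] B.add.m_assoc)
  finally show ?thesis
    by (simp only:) (simp add: coord_\<iota>_add extension_factor_set_apply del: \<iota>_mult)
qed

lemma coord_circ:
  assumes [simp]: "a \<in> carrier B" "b \<in> carrier B"
  shows "coord t (a \<otimes>\<^bsub>B\<^esub> b) =
    coord t a \<otimes>\<^bsub>K\<^esub> coord t b \<otimes>\<^bsub>K\<^esub> snd (extension_factor_set K \<iota> B Q t) (\<pi> a, \<pi> b)"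
proof -
  note [simp] = transversal[OF t] coord_closed
  let ?k = "coord t a" and ?l = "coord t b"
  have "a \<otimes>\<^bsub>B\<^esub> b = (\<iota> ?k \<otimes>\<^bsub>B\<^esub> t (\<pi> a)) \<otimes>\<^bsub>B\<^esub> (\<iota> ?l \<otimes>\<^bsub>B\<^esub> t (\<pi> b))"
    by (simp add: coord_decomp \<iota>_circ)
  also have "\<dots> = \<iota> ?k \<otimes>\<^bsub>B\<^esub> (t (\<pi> a) \<otimes>\<^bsub>B\<^esub> \<iota> ?l) \<otimes>\<^bsub>B\<^esub> t (\<pi> b)"
    by (simp add: B.circ.m_assoc)
  also have "\<dots> = \<iota> ?k \<otimes>\<^bsub>B\<^esub> (\<iota> ?l \<otimes>\<^bsub>B\<^esub> (t (\<pi> a) \<otimes>\<^bsub>B\<^esub> t (\<pi> b)))"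
    by (simp add: \<iota>_circ_commute[of ?l "t (\<pi> a)"] B.circ.m_assoc)
  \<comment> \<open>With the kernel elements collected in front, their circle products become sums,
    the form required by \<open>coord_\<iota>_add\<close>.\<close>
  also have "\<dots> = \<iota> (?k \<otimes>\<^bsub>K\<^esub> ?l) \<oplus>\<^bsub>B\<^esub> (t (\<pi> a) \<otimes>\<^bsub>B\<^esub> t (\<pi> b))"
    by (simp add: \<iota>_circ B.add.m_assoc)
  finally show ?thesis
    by (simp only:) (simp add: coord_\<iota>_add extension_factor_set_apply del: \<iota>_mult)
qed

end

text \<open>Read off the \<open>t\<close>-coordinate of the decomposition of \<open>b\<close> along
  \<open>s\<close>. The correction factor depends only on \<open>\<pi> b\<close>.\<close>

lemma coord_change:
  assumes "s \<in> transversals B \<pi> Q" "t \<in> transversals B \<pi> Q" "b \<in> carrier B"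
  shows "coord t b = coord s b \<otimes>\<^bsub>K\<^esub> coord t (s (\<pi> b))"
  using coord_\<iota>_add[of t "coord s b" "s (\<pi> b)"] coord_closed[of s b] coord_decomp[of s b]
    transversal[OF assms(1)] assms
  by simp

end

section \<open>Inflation, restriction and transgression\<close>

locale annihilator_extension_coefficients =
  annihilator_extension K \<iota> B \<pi> Q + A: comm_group A
  for K :: "('k, 'kx) monoid_scheme" and \<iota> :: "'k \<Rightarrow> 'b" and B :: "('b, 'bx) ring_scheme"
    and \<pi> :: "'b \<Rightarrow> 'q" and Q :: "('q, 'qx) ring_scheme" and A :: "('a, 'ax) monoid_scheme"
begin

sublocale HQ: brace_cohomology Q A ..

sublocale HB: brace_cohomology B A ..

sublocale HK: brace_cohomology "trivial_brace K" A
  by (intro brace_cohomology.intro skew_brace_trivial_brace kernel_abelian A.comm_group_axioms)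

lemma carrier_trivial_brace: "carrier (trivial_brace K) = carrier K"
  by (simp add: trivial_brace_def)

text \<open>Both operations of \<open>trivial_brace K\<close> are the multiplication of
  \<open>K\<close>, so the two homomorphism conditions collapse into one.\<close>

lemma Hom_kernel_iff:
  "\<phi> \<in> carrier (Hom (trivial_brace K) A) \<longleftrightarrow> \<phi> \<in> carrier K \<rightarrow>\<^sub>E carrier A \<and>
    (\<forall>k \<in> carrier K. \<forall>l \<in> carrier K. \<phi> (k \<otimes>\<^bsub>K\<^esub> l) = \<phi> k \<otimes>\<^bsub>A\<^esub> \<phi> l)"
  by (simp add: HK.Hom_carrier_iff) (simp add: trivial_brace_def)

lemma Hom_kernel_apply:
  assumes "\<phi> \<in> carrier (Hom (trivial_brace K) A)"
  shows "k \<in> carrier K \<Longrightarrow> \<phi> k \<in> carrier A"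
    and "\<lbrakk>k \<in> carrier K; l \<in> carrier K\<rbrakk> \<Longrightarrow> \<phi> (k \<otimes>\<^bsub>K\<^esub> l) = \<phi> k \<otimes>\<^bsub>A\<^esub> \<phi> l"
    and "\<phi> \<one>\<^bsub>K\<^esub> = \<one>\<^bsub>A\<^esub>"
  using HK.Hom_apply[OF assms] by (simp_all add: trivial_brace_def)

section \<open>Inflation of cochains and of classes\<close>

definition inflate :: "('q, 'a) cochain_pair \<Rightarrow> ('b, 'a) cochain_pair" where
  "inflate c = (compose (carrier B \<times> carrier B) (fst c) (map_prod \<pi> \<pi>),
    compose (carrier B \<times> carrier B) (snd c) (map_prod \<pi> \<pi>))"

lemma inflate_apply:
  assumes "a \<in> carrier B" "b \<in> carrier B"
  shows "fst (inflate c) (a, b) = fst c (\<pi> a, \<pi> b)" "snd (inflate c) (a, b) = snd c (\<pi> a, \<pi> b)"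
  using assms by (simp_all add: inflate_def compose_def)

lemma inflate_extensional:
  "inflate c \<in> extensional (carrier B \<times> carrier B) \<times> extensional (carrier B \<times> carrier B)"
  by (simp add: inflate_def)

text \<open>By surjectivity, quantifying over \<open>Q\<close> amounts to quantifying over images of
  elements of \<open>B\<close>, and \<open>\<pi>\<close> respects all operations involved. The
  forward direction will give the factor set identities on \<open>Q\<close> for free.\<close>

lemma inflate_factor_set_iff:
  assumes "c \<in> extensional (carrier Q \<times> carrier Q) \<times> extensional (carrier Q \<times> carrier Q)"
  shows "inflate c \<in> factor_sets B A \<longleftrightarrow> c \<in> factor_sets Q A"
proof -
  have Q: "(\<forall>x \<in> carrier Q. P x) \<longleftrightarrow> (\<forall>b \<in> carrier B. P (\<pi> b))" for P
    using \<pi>_surj by (metis image_iff)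
  have carr: "f \<in> S \<times> S \<rightarrow>\<^sub>E T \<longleftrightarrow> f \<in> extensional (S \<times> S) \<and> (\<forall>x \<in> S. \<forall>y \<in> S. f (x, y) \<in> T)"
    for f :: "'x \<times> 'x \<Rightarrow> 'y" and S T
    by (auto simp: PiE_iff)
  show ?thesis
    unfolding HB.factor_sets_iff HQ.factor_sets_iff carr Q
    using assms inflate_extensional[of c] by (simp add: inflate_apply mem_Times_iff cong: conj_cong)
qed

lemma inflate_mult:
  "inflate (c \<otimes>\<^bsub>Z2b Q A\<^esub> d) = inflate c \<otimes>\<^bsub>Z2b B A\<^esub> inflate d"
  by (rule HB.factor_set_ext)
    (use inflate_extensional in \<open>auto simp: HB.Z2b_mult HQ.Z2b_mult inflate_apply\<close>)

lemma inflate_coboundary: "inflate (coboundary Q A h) = coboundary B A (\<lambda>b. h (\<pi> b))"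
  by (rule HB.factor_set_ext)
    (use inflate_extensional HB.coboundary_extensional in
      \<open>auto simp: inflate_apply HQ.coboundary_apply HB.coboundary_apply\<close>)

lemma inflate_B2b: "b \<in> B2b Q A \<Longrightarrow> inflate b \<in> B2b B A"
  by (force simp: HB.B2b_eq HQ.B2b_eq inflate_coboundary)

text \<open>Two representatives of a class differ by a coboundary, which inflates to a coboundary;
  hence \<open>the_elem\<close> is applied to a singleton.\<close>

lemma Inf_H2b_class:
  assumes "c \<in> factor_sets Q A"
  shows "Inf_H2b B \<pi> A (H2b_class Q A c) = H2b_class B A (inflate c)"
proof -
  interpret ZQ: comm_group "Z2b Q A" by (rule HQ.comm_group_Z2b)
  have c: "c \<in> H2b_class Q A c"
    unfolding H2b_class_def using assms ZQ.rcos_self[OF _ HQ.subgroup_B2b]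
    by (simp add: HQ.Z2b_simps)
  have "H2b_class B A (inflate d) = H2b_class B A (inflate c)" if "d \<in> H2b_class Q A c" for d
  proof -
    from that obtain b where "b \<in> B2b Q A" "d = b \<otimes>\<^bsub>Z2b Q A\<^esub> c"
      by (auto simp: H2b_class_def r_coset_def)
    then show ?thesis
      using assms HQ.factor_set_extensional[OF assms]
      by (simp add: inflate_mult HB.H2b_class_coboundary_mult inflate_B2b inflate_factor_set_iff)
  qed
  then have "the_elem ((\<lambda>d. H2b_class B A (inflate d)) ` H2b_class Q A c) = H2b_class B A (inflate c)"
    using c by (intro the_elem_image_unique) blast+
  then show ?thesis
    by (simp add: Inf_H2b_def inflate_def case_prod_unfold)
qed

section \<open>Representatives of the transgression\<close>

definition transgress :: "('k \<Rightarrow> 'a) \<Rightarrow> ('q \<Rightarrow> 'b) \<Rightarrow> ('q, 'a) cochain_pair" where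
  "transgress \<phi> t =
    (compose (carrier Q \<times> carrier Q) \<phi> (fst (extension_factor_set K \<iota> B Q t)),
     compose (carrier Q \<times> carrier Q) \<phi> (snd (extension_factor_set K \<iota> B Q t)))"

lemma transgress_extensional:
  "transgress \<phi> t \<in> extensional (carrier Q \<times> carrier Q) \<times> extensional (carrier Q \<times> carrier Q)"
  by (simp add: transgress_def)

context
  fixes t assumes t[simp]: "t \<in> transversals B \<pi> Q"
begin

lemma transgress_apply:
  assumes "x \<in> carrier Q" "y \<in> carrier Q"
  shows "fst (transgress \<phi> t) (x, y) = \<phi> (fst (extension_factor_set K \<iota> B Q t) (x, y))"
    "snd (transgress \<phi> t) (x, y) = \<phi> (snd (extension_factor_set K \<iota> B Q t) (x, y))"
  using assms by (simp_all add: transgress_def compose_def)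

text \<open>Apply \<open>\<phi>\<close> to \<open>coord_add\<close> and \<open>coord_circ\<close>
  and solve for the cochain value. A coboundary inverts its function at the sum or circle product,
  hence the inverse inside the function here.\<close>

lemma inflate_transgress:
  assumes "\<phi> \<in> carrier (Hom (trivial_brace K) A)"
  shows "inflate (transgress \<phi> t) = coboundary B A (\<lambda>b. inv\<^bsub>A\<^esub> \<phi> (coord t b))"
proof -
  note [simp] = transversal[OF t]
  note \<phi> = Hom_kernel_apply[OF assms]
  \<comment> \<open>Here \<open>a\<close> and \<open>b\<close> stand for the values of
    \<open>\<phi>\<close> at the coordinates of the two arguments, and \<open>x\<close> for the
    cochain value.\<close>
  have cancel: "x = inv\<^bsub>A\<^esub> b \<otimes>\<^bsub>A\<^esub> (a \<otimes>\<^bsub>A\<^esub> b \<otimes>\<^bsub>A\<^esub> x) \<otimes>\<^bsub>A\<^esub> inv\<^bsub>A\<^esub> a"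
    if "a \<in> carrier A" "b \<in> carrier A" "x \<in> carrier A" for a b x
  proof -
    have "a \<otimes>\<^bsub>A\<^esub> b \<otimes>\<^bsub>A\<^esub> x = b \<otimes>\<^bsub>A\<^esub> (x \<otimes>\<^bsub>A\<^esub> a)"
      using that by (simp add: A.m_ac)
    then show ?thesis
      using that by (simp flip: A.m_assoc) (simp add: A.m_assoc)
  qed
  show ?thesis
    by (rule HB.factor_set_ext)
      (use inflate_extensional HB.coboundary_extensional in
        \<open>auto simp: inflate_apply HB.coboundary_apply transgress_apply coord_add coord_circ
          extension_factor_set_closed coord_closed \<phi> intro!: cancel\<close>)
qed

lemma inflate_transgress_B2b:
  assumes "\<phi> \<in> carrier (Hom (trivial_brace K) A)"
  shows "inflate (transgress \<phi> t) \<in> B2b B A"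
proof -
  note [simp] = transversal[OF t]
  have "coord t \<zero>\<^bsub>B\<^esub> = \<one>\<^bsub>K\<^esub>" using coord_\<iota>[of t "\<one>\<^bsub>K\<^esub>"] by simp
  then show ?thesis
    using Hom_kernel_apply[OF assms]
    by (auto simp: inflate_transgress[OF assms] HB.B2b_eq coord_closed)
qed

text \<open>
  The factor set identities need no direct verification: \<open>\<pi>\<close> is surjective and the inflated pair is
  a coboundary.
\<close>

lemma transgress_factor_set:
  assumes "\<phi> \<in> carrier (Hom (trivial_brace K) A)"
  shows "transgress \<phi> t \<in> factor_sets Q A"
  using inflate_transgress_B2b[OF assms] subgroup.subset[OF HB.subgroup_B2b]
    inflate_factor_set_iff[OF transgress_extensional] by (auto simp: HB.Z2b_simps)

end

text \<open>The transversals differ by a \<open>K\<close>-valued map on \<open>Q\<close>, the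
  \<open>t\<close>-coordinate of \<open>s x\<close>; its image under \<open>\<phi>\<close> is the
  \<open>?h\<close> whose coboundary relates the two cochain pairs.\<close>

lemma transgress_change:
  assumes \<phi>: "\<phi> \<in> carrier (Hom (trivial_brace K) A)"
    and s[simp]: "s \<in> transversals B \<pi> Q" and t[simp]: "t \<in> transversals B \<pi> Q"
  shows "H2b_class Q A (transgress \<phi> s) = H2b_class Q A (transgress \<phi> t)"
proof -
  note [simp] = transversal[OF s] transversal[OF t]
  let ?h = "\<lambda>x. \<phi> (coord t (s x))"
  note \<phi>' = Hom_kernel_apply[OF \<phi>]
  have h: "?h \<in> carrier Q \<rightarrow> carrier A"
    by (auto simp: \<phi>' coord_closed)
  have h0: "?h \<zero>\<^bsub>Q\<^esub> = \<one>\<^bsub>A\<^esub>"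
    using \<phi>'(3) coord_\<iota>[of t "\<one>\<^bsub>K\<^esub>"] by simp
  have cancel: "x = b \<otimes>\<^bsub>A\<^esub> inv\<^bsub>A\<^esub> c \<otimes>\<^bsub>A\<^esub> a \<otimes>\<^bsub>A\<^esub> y"
    if "x \<otimes>\<^bsub>A\<^esub> c = a \<otimes>\<^bsub>A\<^esub> b \<otimes>\<^bsub>A\<^esub> y"
      "a \<in> carrier A" "b \<in> carrier A" "c \<in> carrier A" "x \<in> carrier A" "y \<in> carrier A" for a b c x y
    using that A.quotient_eq_iff[of b c "a \<otimes>\<^bsub>A\<^esub> y" x] by (simp add: A.m_ac)
  have "transgress \<phi> s = coboundary Q A ?h \<otimes>\<^bsub>Z2b Q A\<^esub> transgress \<phi> t"
  proof (rule HQ.factor_set_ext)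
    fix x y assume [simp]: "x \<in> carrier Q" "y \<in> carrier Q"
    \<comment> \<open>For \<open>b\<close> the sum or circle product of \<open>s x\<close> and
      \<open>s y\<close>, the \<open>s\<close>-coordinate is the factor set of \<open>s\<close>,
      while the \<open>t\<close>-coordinate expands by \<open>coord_add\<close> or
      \<open>coord_circ\<close>.\<close>
    have eq: "\<phi> (coord s b) \<otimes>\<^bsub>A\<^esub> ?h (\<pi> b) = \<phi> (coord t b)" if "b \<in> carrier B" for b
      using coord_change[of s t b] that by (simp add: \<phi>' coord_closed)
    show "fst (transgress \<phi> s) (x, y) = fst (coboundary Q A ?h \<otimes>\<^bsub>Z2b Q A\<^esub> transgress \<phi> t) (x, y)"
      using eq[of "s x \<oplus>\<^bsub>B\<^esub> s y"] HQ.coboundary_mult_apply[OF h]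
      by (simp add: HQ.Z2b_mult HQ.coboundary_apply transgress_apply,
        intro cancel)
       (auto simp: \<phi>' coord_closed coord_add coord_transversal extension_factor_set_closed)
    show "snd (transgress \<phi> s) (x, y) = snd (coboundary Q A ?h \<otimes>\<^bsub>Z2b Q A\<^esub> transgress \<phi> t) (x, y)"
      using eq[of "s x \<otimes>\<^bsub>B\<^esub> s y"] HQ.coboundary_mult_apply[OF h]
      by (simp add: HQ.Z2b_mult HQ.coboundary_apply transgress_apply,
        intro cancel)
       (auto simp: \<phi>' coord_closed coord_circ coord_transversal extension_factor_set_closed)
  qed (auto simp: transgress_def HQ.Z2b_mult)
  then show ?thesis
    using h h0 \<phi> HQ.H2b_class_coboundary_mult[OF transgress_factor_set[of t \<phi>]]
    by (auto simp: HQ.B2b_eq)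
qed

lemma Tra_eq:
  assumes "\<phi> \<in> carrier (Hom (trivial_brace K) A)" "t \<in> transversals B \<pi> Q"
  shows "Tra K \<iota> B \<pi> Q A \<phi> = H2b_class Q A (transgress \<phi> t)"
proof -
  have "the_elem ((\<lambda>t. H2b_class Q A (transgress \<phi> t)) ` transversals B \<pi> Q)
    = H2b_class Q A (transgress \<phi> t)"
    using assms transgress_change by (intro the_elem_image_unique) blast+
  then show ?thesis
    by (simp add: Tra_def transgress_def case_prod_unfold Let_def)
qed

section \<open>The four maps as group homomorphisms\<close>

lemma Inf_Hom_group_hom: "group_hom (Hom Q A) (Hom B A) (Inf_Hom B \<pi>)"
proof (intro group_hom.intro group_hom_axioms.intro homI)
  show "group (Hom Q A)" "group (Hom B A)"
    using HQ.comm_group_Hom HB.comm_group_Hom by (simp_all add: comm_group_def)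
  show "Inf_Hom B \<pi> f \<in> carrier (Hom B A)" if "f \<in> carrier (Hom Q A)" for f
    using that by (auto simp: HB.Hom_carrier_iff HQ.Hom_carrier_iff Inf_Hom_def compose_def PiE_iff)
  show "Inf_Hom B \<pi> (f \<otimes>\<^bsub>Hom Q A\<^esub> g) = Inf_Hom B \<pi> f \<otimes>\<^bsub>Hom B A\<^esub> Inf_Hom B \<pi> g" for f g
    by (auto simp: Inf_Hom_def Hom_def compose_def fun_eq_iff)
qed

lemma Res_Hom_group_hom: "group_hom (Hom B A) (Hom (trivial_brace K) A) (Res_Hom K \<iota>)"
proof (intro group_hom.intro group_hom_axioms.intro homI)
  show "group (Hom B A)" "group (Hom (trivial_brace K) A)"
    using HK.comm_group_Hom HB.comm_group_Hom by (simp_all add: comm_group_def)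
  show "Res_Hom K \<iota> f \<in> carrier (Hom (trivial_brace K) A)" if "f \<in> carrier (Hom B A)" for f
    using that by (auto simp: HB.Hom_carrier_iff Hom_kernel_iff Res_Hom_def compose_def PiE_iff)
  show "Res_Hom K \<iota> (f \<otimes>\<^bsub>Hom B A\<^esub> g) = Res_Hom K \<iota> f \<otimes>\<^bsub>Hom (trivial_brace K) A\<^esub> Res_Hom K \<iota> g"
    for f g
    by (auto simp: Res_Hom_def Hom_def compose_def carrier_trivial_brace fun_eq_iff)
qed

lemma Tra_group_hom: "group_hom (Hom (trivial_brace K) A) (H2b Q A) (Tra K \<iota> B \<pi> Q A)"
proof (intro group_hom.intro group_hom_axioms.intro homI)
  show "group (Hom (trivial_brace K) A)" "group (H2b Q A)"
    using HK.comm_group_Hom HQ.group_H2b by (simp_all add: comm_group_def)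
  \<comment> \<open>A single transversal represents all values of \<open>Tra\<close>, so that
    representatives multiply pointwise.\<close>
  obtain t where t: "t \<in> transversals B \<pi> Q" using transversal_exists by blast
  fix \<phi> assume \<phi>: "\<phi> \<in> carrier (Hom (trivial_brace K) A)"
  then show "Tra K \<iota> B \<pi> Q A \<phi> \<in> carrier (H2b Q A)"
    by (simp add: Tra_eq[OF _ t] HQ.carrier_H2b transgress_factor_set[OF t])
  fix \<psi> assume \<psi>: "\<psi> \<in> carrier (Hom (trivial_brace K) A)"
  let ?\<chi> = "\<phi> \<otimes>\<^bsub>Hom (trivial_brace K) A\<^esub> \<psi>"
  have \<chi>: "?\<chi> \<in> carrier (Hom (trivial_brace K) A)"
    using \<phi> \<psi> HK.comm_group_Hom by (simp add: comm_group_def group.is_monoid monoid.m_closed)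
  have "?\<chi> k = \<phi> k \<otimes>\<^bsub>A\<^esub> \<psi> k" if "k \<in> carrier K" for k
    using that by (simp add: Hom_def carrier_trivial_brace)
  then have "transgress ?\<chi> t = transgress \<phi> t \<otimes>\<^bsub>Z2b Q A\<^esub> transgress \<psi> t"
    using t transgress_extensional by (intro HQ.factor_set_ext)
      (auto simp: HQ.Z2b_mult transgress_apply extension_factor_set_closed)
  then show "Tra K \<iota> B \<pi> Q A ?\<chi> = Tra K \<iota> B \<pi> Q A \<phi> \<otimes>\<^bsub>H2b Q A\<^esub> Tra K \<iota> B \<pi> Q A \<psi>"
    using \<phi> \<psi> \<chi> by (simp add: Tra_eq[OF _ t] HQ.mult_H2b transgress_factor_set[OF t])
qed

lemma Inf_H2b_group_hom: "group_hom (H2b Q A) (H2b B A) (Inf_H2b B \<pi> A)"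
proof (intro group_hom.intro group_hom_axioms.intro homI)
  show "group (H2b Q A)" "group (H2b B A)"
    by (rule HQ.group_H2b HB.group_H2b)+
  have inflate: "inflate c \<in> factor_sets B A" if "c \<in> factor_sets Q A" for c
    using that HQ.factor_set_extensional inflate_factor_set_iff by blast
  show "Inf_H2b B \<pi> A X \<in> carrier (H2b B A)" if "X \<in> carrier (H2b Q A)" for X
    using that by (auto simp: HQ.carrier_H2b HB.carrier_H2b Inf_H2b_class inflate)
  show "Inf_H2b B \<pi> A (X \<otimes>\<^bsub>H2b Q A\<^esub> Y) = Inf_H2b B \<pi> A X \<otimes>\<^bsub>H2b B A\<^esub> Inf_H2b B \<pi> A Y"
    if "X \<in> carrier (H2b Q A)" "Y \<in> carrier (H2b Q A)" for X Y
    using that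
    by (auto simp: HQ.carrier_H2b Inf_H2b_class inflate HQ.mult_H2b HB.mult_H2b
        HQ.factor_sets_mult_closed inflate_mult)
qed

section \<open>Exactness at the four places\<close>

lemma exact_Hom_Q:
  "exact_at (singleton_group ()) (\<lambda>_. \<one>\<^bsub>Hom Q A\<^esub>) (Hom Q A) (Inf_Hom B \<pi>) (Hom B A)"
proof -
  interpret Inf: group_hom "Hom Q A" "Hom B A" "Inf_Hom B \<pi>" by (rule Inf_Hom_group_hom)
  have "f = \<one>\<^bsub>Hom Q A\<^esub>" if f: "f \<in> carrier (Hom Q A)" and eq: "Inf_Hom B \<pi> f = \<one>\<^bsub>Hom B A\<^esub>" for f
  proof -
    have "f (\<pi> b) = \<one>\<^bsub>A\<^esub>" if "b \<in> carrier B" for b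
      using fun_cong[OF eq, of b] that by (simp add: Inf_Hom_def compose_def Hom_def)
    then have "f x = \<one>\<^bsub>A\<^esub>" if "x \<in> carrier Q" for x
      using that \<pi>_surj by (metis imageE)
    then show ?thesis
      using f by (auto simp: HQ.Hom_carrier_iff PiE_iff extensional_def) (auto simp: Hom_def)
  qed
  moreover have "group_hom (singleton_group ()) (Hom Q A) (\<lambda>_. \<one>\<^bsub>Hom Q A\<^esub>)"
    by (intro group_hom.intro group_hom_axioms.intro) (auto simp: hom_def)
  ultimately show ?thesis
    by (auto simp: exact_at_def kernel_def Inf_Hom_group_hom)
qed

text \<open>A homomorphism trivial on the image of \<open>\<iota>\<close> is constant on the fibres
  of \<open>\<pi>\<close> and descends to \<open>Q\<close>; the transversal merely picks a point of
  each fibre.\<close>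

lemma exact_Hom_B:
  "exact_at (Hom Q A) (Inf_Hom B \<pi>) (Hom B A) (Res_Hom K \<iota>) (Hom (trivial_brace K) A)"
proof -
  interpret Inf: group_hom "Hom Q A" "Hom B A" "Inf_Hom B \<pi>" by (rule Inf_Hom_group_hom)
  obtain t where t[simp]: "t \<in> transversals B \<pi> Q" using transversal_exists by blast
  note [simp] = transversal[OF t]
  have "Inf_Hom B \<pi> ` carrier (Hom Q A) = kernel (Hom B A) (Hom (trivial_brace K) A) (Res_Hom K \<iota>)"
  proof (intro equalityI subsetI)
    fix f assume "f \<in> Inf_Hom B \<pi> ` carrier (Hom Q A)"
    then obtain g where g: "g \<in> carrier (Hom Q A)" "f = Inf_Hom B \<pi> g" by blast
    have "Res_Hom K \<iota> f = \<one>\<^bsub>Hom (trivial_brace K) A\<^esub>"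
      using g HQ.Hom_zero[OF g(1)] by (auto simp: Res_Hom_def Inf_Hom_def compose_def Hom_def carrier_trivial_brace fun_eq_iff)
    then show "f \<in> kernel (Hom B A) (Hom (trivial_brace K) A) (Res_Hom K \<iota>)"
      using g by (simp add: kernel_def)
  next
    fix f assume "f \<in> kernel (Hom B A) (Hom (trivial_brace K) A) (Res_Hom K \<iota>)"
    then have f: "f \<in> carrier (Hom B A)" and res: "Res_Hom K \<iota> f = \<one>\<^bsub>Hom (trivial_brace K) A\<^esub>"
      by (auto simp: kernel_def)
    note f_hom[simp] = HB.Hom_apply[OF f]
    have f_\<iota>: "f (\<iota> k) = \<one>\<^bsub>A\<^esub>" if "k \<in> carrier K" for k
      using fun_cong[OF res, of k] that
      by (simp add: Res_Hom_def compose_def Hom_def carrier_trivial_brace)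
    have f_\<pi>: "f (t (\<pi> b)) = f b" if b: "b \<in> carrier B" for b
    proof -
      have "f b = f (\<iota> (coord t b) \<oplus>\<^bsub>B\<^esub> t (\<pi> b))"
        using b by (simp only: coord_decomp[OF t])
      then show ?thesis using b by (simp add: f_\<iota> coord_closed)
    qed
    define g where "g = (\<lambda>x \<in> carrier Q. f (t x))"
    \<comment> \<open>The transversal need not be a homomorphism, but in each equation the two
      arguments compared lie in the same fibre.\<close>
    have "f (t (x \<oplus>\<^bsub>Q\<^esub> y)) = f (t x) \<otimes>\<^bsub>A\<^esub> f (t y)" "f (t (x \<otimes>\<^bsub>Q\<^esub> y)) = f (t x) \<otimes>\<^bsub>A\<^esub> f (t y)"
      if "x \<in> carrier Q" "y \<in> carrier Q" for x y
      using f_\<pi>[of "t x \<oplus>\<^bsub>B\<^esub> t y"] f_\<pi>[of "t x \<otimes>\<^bsub>B\<^esub> t y"] that by simp_all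
    then have "g \<in> carrier (Hom Q A)"
      unfolding HQ.Hom_carrier_iff g_def by auto
    moreover have "Inf_Hom B \<pi> g = f"
      using f by (auto simp: Inf_Hom_def compose_def g_def f_\<pi> fun_eq_iff HB.Hom_carrier_iff
          PiE_iff extensional_def)
    ultimately show "f \<in> Inf_Hom B \<pi> ` carrier (Hom Q A)" by blast
  qed
  then show ?thesis
    by (simp add: exact_at_def Inf_Hom_group_hom Res_Hom_group_hom)
qed

lemma exact_Hom_K:
  "exact_at (Hom B A) (Res_Hom K \<iota>) (Hom (trivial_brace K) A) (Tra K \<iota> B \<pi> Q A) (H2b Q A)"
proof -
  interpret Res: group_hom "Hom B A" "Hom (trivial_brace K) A" "Res_Hom K \<iota>"
    by (rule Res_Hom_group_hom)
  obtain t where t[simp]: "t \<in> transversals B \<pi> Q" using transversal_exists by blast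
  note [simp] = transversal[OF t]
  note [simp] = coord_closed extension_factor_set_closed
  have Tra_one_iff: "Tra K \<iota> B \<pi> Q A \<phi> = \<one>\<^bsub>H2b Q A\<^esub> \<longleftrightarrow> transgress \<phi> t \<in> B2b Q A"
    if "\<phi> \<in> carrier (Hom (trivial_brace K) A)" for \<phi>
    using that
    by (simp add: Tra_eq[OF _ t] HQ.one_H2b HQ.H2b_class_eq_one_iff transgress_factor_set)
  have "Res_Hom K \<iota> ` carrier (Hom B A) = kernel (Hom (trivial_brace K) A) (H2b Q A) (Tra K \<iota> B \<pi> Q A)"
  proof (intro equalityI subsetI)
    fix \<phi> assume "\<phi> \<in> Res_Hom K \<iota> ` carrier (Hom B A)"
    then obtain f where f: "f \<in> carrier (Hom B A)" "\<phi> = Res_Hom K \<iota> f" by blast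
    note f_hom[simp] = HB.Hom_apply[OF f(1)]
    have \<phi>: "f b = \<phi> (coord t b) \<otimes>\<^bsub>A\<^esub> f (t (\<pi> b))" if "b \<in> carrier B" for b
    proof -
      have "f b = f (\<iota> (coord t b) \<oplus>\<^bsub>B\<^esub> t (\<pi> b))"
        using that by (simp only: coord_decomp[OF t])
      then show ?thesis using that f(2) by (simp add: Res_Hom_def compose_def)
    qed
    have \<phi>_closed: "\<phi> k \<in> carrier A" if "k \<in> carrier K" for k
      using that f(2) by (simp add: Res_Hom_def compose_def)
    have quot: "x = b \<otimes>\<^bsub>A\<^esub> inv\<^bsub>A\<^esub> c \<otimes>\<^bsub>A\<^esub> a" if "a \<otimes>\<^bsub>A\<^esub> b = x \<otimes>\<^bsub>A\<^esub> c"
      "a \<in> carrier A" "b \<in> carrier A" "c \<in> carrier A" "x \<in> carrier A" for a b c x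
      using that A.quotient_eq_iff[of b c a x] by (simp add: A.m_comm)
    \<comment> \<open>Evaluate \<open>f\<close> on the decompositions of the sum and of the circle
      product of \<open>t x\<close> and \<open>t y\<close>: their \<open>K\<close>-parts are the
      factor set values.\<close>
    have "transgress \<phi> t = coboundary Q A (\<lambda>x. f (t x))"
    proof (rule HQ.factor_set_ext)
      fix x y assume [simp]: "x \<in> carrier Q" "y \<in> carrier Q"
      show "fst (transgress \<phi> t) (x, y) = fst (coboundary Q A (\<lambda>x. f (t x))) (x, y)"
        using \<phi>[of "t x \<oplus>\<^bsub>B\<^esub> t y"]
        by (simp add: transgress_apply HQ.coboundary_apply \<phi>_closed quot coord_add coord_circ
            coord_transversal)
      show "snd (transgress \<phi> t) (x, y) = snd (coboundary Q A (\<lambda>x. f (t x))) (x, y)"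
        using \<phi>[of "t x \<otimes>\<^bsub>B\<^esub> t y"]
        by (simp add: transgress_apply HQ.coboundary_apply \<phi>_closed quot coord_add coord_circ
            coord_transversal)
    qed (rule transgress_extensional HQ.coboundary_extensional)+
    then have "transgress \<phi> t \<in> B2b Q A"
      by (auto simp: HQ.B2b_eq)
    then show "\<phi> \<in> kernel (Hom (trivial_brace K) A) (H2b Q A) (Tra K \<iota> B \<pi> Q A)"
      using f Tra_one_iff by (simp add: kernel_def)
  next
    fix \<phi> assume "\<phi> \<in> kernel (Hom (trivial_brace K) A) (H2b Q A) (Tra K \<iota> B \<pi> Q A)"
    then have \<phi>: "\<phi> \<in> carrier (Hom (trivial_brace K) A)" and "transgress \<phi> t \<in> B2b Q A"
      by (auto simp: kernel_def Tra_one_iff)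
    then obtain h where eq: "transgress \<phi> t = coboundary Q A h"
      and h: "h \<in> carrier Q \<rightarrow> carrier A" and h0: "h \<zero>\<^bsub>Q\<^esub> = \<one>\<^bsub>A\<^esub>"
      by (auto simp: HQ.B2b_eq)
    have [simp]: "h x \<in> carrier A" if "x \<in> carrier Q" for x
      using h that by auto
    note \<phi>_hom = Hom_kernel_apply[OF \<phi>]
    define f where "f = (\<lambda>b \<in> carrier B. \<phi> (coord t b) \<otimes>\<^bsub>A\<^esub> h (\<pi> b))"
    \<comment> \<open>In this form, the assumed equality says that \<open>h\<close> absorbs the
      factor set terms arising from \<open>coord_add\<close> and \<open>coord_circ\<close>.\<close>
    have "\<phi> (fst (extension_factor_set K \<iota> B Q t) (x, y)) \<otimes>\<^bsub>A\<^esub> h (x \<oplus>\<^bsub>Q\<^esub> y) = h x \<otimes>\<^bsub>A\<^esub> h y"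
      "\<phi> (snd (extension_factor_set K \<iota> B Q t) (x, y)) \<otimes>\<^bsub>A\<^esub> h (x \<otimes>\<^bsub>Q\<^esub> y) = h x \<otimes>\<^bsub>A\<^esub> h y"
      if "x \<in> carrier Q" "y \<in> carrier Q" for x y
      using HQ.coboundary_mult_apply[OF h that] that by (simp_all add: transgress_apply flip: eq)
    then have "f \<in> carrier (Hom B A)"
      unfolding HB.Hom_carrier_iff f_def
      by (auto simp: \<phi>_hom coord_add coord_circ extension_factor_set_closed A.m_assoc)
        (simp_all add: \<phi>_hom extension_factor_set_closed A.m_ac)
    \<comment> \<open>On \<open>\<iota> k\<close> the coordinate is \<open>k\<close>, and
      \<open>h\<close> contributes its normalised value at zero.\<close>
    moreover have "Res_Hom K \<iota> f = \<phi>"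
      using \<phi> by (auto simp: Res_Hom_def compose_def f_def coord_\<iota> h0 \<phi>_hom fun_eq_iff
          Hom_kernel_iff PiE_iff extensional_def)
    ultimately show "\<phi> \<in> Res_Hom K \<iota> ` carrier (Hom B A)" by blast
  qed
  then show ?thesis
    by (simp add: exact_at_def Res_Hom_group_hom Tra_group_hom)
qed

lemma exact_H2b_Q:
  "exact_at (Hom (trivial_brace K) A) (Tra K \<iota> B \<pi> Q A) (H2b Q A) (Inf_H2b B \<pi> A) (H2b B A)"
proof -
  interpret Tra: group_hom "Hom (trivial_brace K) A" "H2b Q A" "Tra K \<iota> B \<pi> Q A"
    by (rule Tra_group_hom)
  obtain t where t[simp]: "t \<in> transversals B \<pi> Q" using transversal_exists by blast
  note [simp] = transversal[OF t]
  note [simp] = coord_closed extension_factor_set_closed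
  have Inf_one_iff: "Inf_H2b B \<pi> A (H2b_class Q A c) = \<one>\<^bsub>H2b B A\<^esub> \<longleftrightarrow> inflate c \<in> B2b B A"
    if "c \<in> factor_sets Q A" for c
    using that HQ.factor_set_extensional[OF that] inflate_factor_set_iff[of c]
    by (simp add: Inf_H2b_class HB.one_H2b HB.H2b_class_eq_one_iff)
  have "Tra K \<iota> B \<pi> Q A ` carrier (Hom (trivial_brace K) A) = kernel (H2b Q A) (H2b B A) (Inf_H2b B \<pi> A)"
  proof (intro equalityI subsetI)
    fix X assume "X \<in> Tra K \<iota> B \<pi> Q A ` carrier (Hom (trivial_brace K) A)"
    then obtain \<phi> where \<phi>: "\<phi> \<in> carrier (Hom (trivial_brace K) A)" "X = Tra K \<iota> B \<pi> Q A \<phi>"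
      by blast
    then have "Inf_H2b B \<pi> A X = \<one>\<^bsub>H2b B A\<^esub>"
      using Inf_one_iff[OF transgress_factor_set[OF t \<phi>(1)]] inflate_transgress_B2b[OF t \<phi>(1)]
      by (simp add: Tra_eq[OF _ t])
    then show "X \<in> kernel (H2b Q A) (H2b B A) (Inf_H2b B \<pi> A)"
      using \<phi> by (simp add: kernel_def)
  next
    fix X assume "X \<in> kernel (H2b Q A) (H2b B A) (Inf_H2b B \<pi> A)"
    then obtain c where c: "c \<in> factor_sets Q A" "X = H2b_class Q A c" "inflate c \<in> B2b B A"
      by (auto simp: kernel_def HQ.carrier_H2b Inf_one_iff)
    from c(3) obtain h where eq: "inflate c = coboundary B A h"
      and h: "h \<in> carrier B \<rightarrow> carrier A" and h0: "h \<zero>\<^bsub>B\<^esub> = \<one>\<^bsub>A\<^esub>"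
      by (auto simp: HB.B2b_eq)
    have [simp]: "h b \<in> carrier A" if "b \<in> carrier B" for b
      using h that by auto
    have c_mult: "fst c (\<pi> a, \<pi> b) \<otimes>\<^bsub>A\<^esub> h (a \<oplus>\<^bsub>B\<^esub> b) = h a \<otimes>\<^bsub>A\<^esub> h b"
      "snd c (\<pi> a, \<pi> b) \<otimes>\<^bsub>A\<^esub> h (a \<otimes>\<^bsub>B\<^esub> b) = h a \<otimes>\<^bsub>A\<^esub> h b"
      if "a \<in> carrier B" "b \<in> carrier B" for a b
      using HB.coboundary_mult_apply[OF h that] that by (simp_all add: inflate_apply flip: eq)
    \<comment> \<open>Since \<open>\<pi>\<close> sends \<open>\<iota> k\<close> to zero, the
      additive cochain of \<open>c\<close> takes the value one here.\<close>
    have h_\<iota>: "h (\<iota> k \<oplus>\<^bsub>B\<^esub> b) = h (\<iota> k) \<otimes>\<^bsub>A\<^esub> h b" if "k \<in> carrier K" "b \<in> carrier B" for k b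
      using c_mult(1)[of "\<iota> k" b] HQ.factor_set_zero_left[OF c(1), of "\<pi> b"] that by simp
    \<comment> \<open>The inverse undoes the one in \<open>inflate_transgress\<close>.\<close>
    define \<phi> where "\<phi> = (\<lambda>k \<in> carrier K. inv\<^bsub>A\<^esub> h (\<iota> k))"
    have \<phi>: "\<phi> \<in> carrier (Hom (trivial_brace K) A)"
      by (auto simp: Hom_kernel_iff \<phi>_def h_\<iota> A.inv_mult)
    have h_decomp: "h b = h (\<iota> (coord t b)) \<otimes>\<^bsub>A\<^esub> h (t (\<pi> b))" if "b \<in> carrier B" for b
      using h_\<iota>[of "coord t b" "t (\<pi> b)"] that by (simp add: coord_decomp)
    \<comment> \<open>In use, \<open>d\<close> and \<open>c\<close> are the values of
      \<open>h\<close> at the kernel part and at the transversal part of a sum or circle product, so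
      \<open>inv d\<close> is a value of \<open>\<phi>\<close>.\<close>
    have quot: "x = b \<otimes>\<^bsub>A\<^esub> inv\<^bsub>A\<^esub> c \<otimes>\<^bsub>A\<^esub> a \<otimes>\<^bsub>A\<^esub> inv\<^bsub>A\<^esub> d"
      if "x \<otimes>\<^bsub>A\<^esub> (d \<otimes>\<^bsub>A\<^esub> c) = a \<otimes>\<^bsub>A\<^esub> b"
      "a \<in> carrier A" "b \<in> carrier A" "c \<in> carrier A" "d \<in> carrier A" "x \<in> carrier A" for a b c d x
    proof -
      have "b \<otimes>\<^bsub>A\<^esub> a = c \<otimes>\<^bsub>A\<^esub> (x \<otimes>\<^bsub>A\<^esub> d)"
        using that(2-) that(1)[symmetric] by (simp add: A.m_ac)
      then have "b \<otimes>\<^bsub>A\<^esub> inv\<^bsub>A\<^esub> c \<otimes>\<^bsub>A\<^esub> a = x \<otimes>\<^bsub>A\<^esub> d"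
        using that by (simp only: A.quotient_eq_iff A.m_closed)
      then show ?thesis using that by (simp add: A.m_assoc)
    qed
    have "c = coboundary Q A (\<lambda>x. h (t x)) \<otimes>\<^bsub>Z2b Q A\<^esub> transgress \<phi> t"
    proof (rule HQ.factor_set_ext)
      fix x y assume [simp]: "x \<in> carrier Q" "y \<in> carrier Q"
      show "fst c (x, y) = fst (coboundary Q A (\<lambda>x. h (t x)) \<otimes>\<^bsub>Z2b Q A\<^esub> transgress \<phi> t) (x, y)"
        using c_mult(1)[of "t x" "t y"] h_decomp[of "t x \<oplus>\<^bsub>B\<^esub> t y"] HQ.factor_set_closed[OF c(1)]
        by (simp add: HQ.Z2b_mult HQ.coboundary_apply transgress_apply \<phi>_def quot
            coord_add coord_circ coord_transversal)
      show "snd c (x, y) = snd (coboundary Q A (\<lambda>x. h (t x)) \<otimes>\<^bsub>Z2b Q A\<^esub> transgress \<phi> t) (x, y)"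
        using c_mult(2)[of "t x" "t y"] h_decomp[of "t x \<otimes>\<^bsub>B\<^esub> t y"] HQ.factor_set_closed[OF c(1)]
        by (simp add: HQ.Z2b_mult HQ.coboundary_apply transgress_apply \<phi>_def quot
            coord_add coord_circ coord_transversal)
    qed (use HQ.factor_set_extensional[OF c(1)] in \<open>auto simp: HQ.Z2b_mult\<close>)
    moreover have "coboundary Q A (\<lambda>x. h (t x)) \<in> B2b Q A"
      by (auto simp: HQ.B2b_eq h0)
    ultimately have "X = H2b_class Q A (transgress \<phi> t)"
      using c(2) HQ.H2b_class_coboundary_mult[OF transgress_factor_set[OF t \<phi>]] by simp
    then show "X \<in> Tra K \<iota> B \<pi> Q A ` carrier (Hom (trivial_brace K) A)"
      using \<phi> Tra_eq[OF \<phi> t] by blast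
  qed
  then show ?thesis
    by (simp add: exact_at_def Tra_group_hom Inf_H2b_group_hom)
qed

end

theorem theorem1p40:
  fixes K :: "('k, 'kx) monoid_scheme"
    and \<iota> :: "'k \<Rightarrow> 'b"
    and B :: "('b, 'bx) ring_scheme"
    and \<pi> :: "'b \<Rightarrow> 'q"
    and Q :: "('q, 'qx) ring_scheme"
    and A :: "('a, 'ax) monoid_scheme"
  assumes "annihilator_extension K \<iota> B \<pi> Q"
    and "comm_group A"
  shows "exact_at (singleton_group ()) (\<lambda>_. \<one>\<^bsub>Hom Q A\<^esub>) (Hom Q A) (Inf_Hom B \<pi>) (Hom B A)
    \<and> exact_at (Hom Q A) (Inf_Hom B \<pi>) (Hom B A) (Res_Hom K \<iota>) (Hom (trivial_brace K) A)
    \<and> exact_at (Hom B A) (Res_Hom K \<iota>) (Hom (trivial_brace K) A) (Tra K \<iota> B \<pi> Q A) (H2b Q A)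
    \<and> exact_at (Hom (trivial_brace K) A) (Tra K \<iota> B \<pi> Q A) (H2b Q A) (Inf_H2b B \<pi> A) (H2b B A)"
proof -
  interpret annihilator_extension_coefficients K \<iota> B \<pi> Q A
    using assms by (rule annihilator_extension_coefficients.intro)
  show ?thesis
    by (intro conjI exact_Hom_Q exact_Hom_B exact_Hom_K exact_H2b_Q)
qed

end
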